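(* Suppose there exist positive constants $M,\sigma_{\min},R_y,\sigma_\eta$ such that (i) $\|X_t\|_2\le M$ a.s.; (ii) $\mathbb E[X_tX_t^\top]\succeq\sigma_{\min}^2I$; (iii) there is a function $y(x,a)$ with $Y_t=y(X_t,A_t)+\eta_t$, where $\eta_t$ are independent noise variables with $\mathbb E[\eta_t]=0$ and $\mathbb E[\eta_t^2]\le\sigma_\eta^2$, and $|y(x,a)|\le R_y<\infty$ for all $\|x\|_2\le M$ and $a\in\mathcal A$. Let the data be collected using the behavior policy $\{\tilde\pi^\gamma(\cdot\mid X_t,\hat\beta_t^{\mathrm{Ridge}})\}_{t\ge1}$ (clipped Boltzmann policy with temperature $\gamma>0$), where $\hat\beta_t^{\mathrm{Ridge}}=(\hat\beta_{t,a}^{\mathrm{Ridge}})_{a\in\mathcal A}$, $$\hat\beta_{t,a}^{\mathrm{Ridge}}=\Big(\lambda I+\sum_{\tau=1}^{t-1}1_{\{A_\tau=a\}}X_\tau X_\tau^\top\Big)^{-1}\Big(\sum_{\tau=1}^{t-1}1_{\{A_\tau=a\}}X_\tau Y_\tau\Big),\qquad\lambda>0.$$ If $$\gamma\ge2M^3\max\Big\{\frac2{\pi_{\min}\sigma_{\min}^2},\ \frac{8(MR_y+4M\sigma_\eta\sqrt{dK})}{\pi_{\min}^2\sigma_{\min}^4}\Big\}K(K+1),$$ then there exists a deterministic vector $\bar\beta\in\mathbb R^{Kd}$ such that $\hat\beta_t^{\mathrm{Ridge}}\xrightarrow{p}\bar\beta$. Consequently, the policy converges: there is a stationary policy $\bar\pi:\mathcal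 X\to\Delta(\mathcal A)$ with $\tilde\pi^\gamma(a\mid X_t,\hat\beta_t^{\mathrm{Ridge}})-\bar\pi(a\mid X_t)\xrightarrow{p}0$ as $t\to\infty$ for every $a\in\mathcal A$.
   Context: Contextual bandit setting. Contexts $X_t\in\mathcal X\subseteq\mathbb R^{d}$, finite action set $\mathcal A=\{1,\dots,K\}$, potential outcomes $Y_t(a)\in\mathbb R$; the tuples $(X_t,\{Y_t(a)\}_{a\in\mathcal A})$, $t\ge1$, are i.i.d. At time $t$, given the history $\mathcal H_{t-1}=\{X_\tau,\pi_\tau,A_\tau,Y_\tau\}_{\tau<t}$ and $X_t$, the action $A_t$ is drawn from the behavior policy, and $Y_t=Y_t(A_t)$ is observed; $A_t\perp\{Y_t(a)\}_{a}\mid(\mathcal H_{t-1},X_t)$, and $(X_t,\{Y_t(a)\}_a)$ is independent of $\mathcal H_{t-1}$. The noise $\eta_t$ is independent across $t$ and independent of $(\mathcal H_{t-1},X_t,A_t)$. The mean reward need not be linear. Boltzmann policy: for $\beta=(\beta_a)_{a\in\mathcal A}$, $\beta_a\in\mathbb R^d$, $\pi^\gamma(a\mid x,\beta)=\exp(\langle\beta_a,x\rangle/\gamma)/\sum_{a'\in\mathcal A}\exp(\langle\beta_{a'},x\rangle/\gamma)$. Clipped version: $\tilde\pi^\gamma(\cdot\mid x,\beta)=\mathrm{Clip}(\pi^\gamma(\cdot\mid x,\beta))$, where for $\boldsymbol\pi\in[0,1]^K$, $\mathrm{Clip}(\boldsymbol\pi)_a=\max\{\boldsymbol\pi_a-\nu^*(\boldsymbol\pi),\pi_{\min}\}$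 and $\nu^*(\boldsymbol\pi)$ is the unique $\nu$ with $\sum_{a}\max\{\boldsymbol\pi_a-\nu,\pi_{\min}\}=1$; $\pi_{\min}\in(0,1)$ is a constant with $K\pi_{\min}<1$. *)

theory Defs
  imports "HOL-Probability.Probability"
begin
text \<open>
  Library constant \<open>indep_var\<close> forces both random variables to have the same value type;
  the following is the heterogeneous version.
\<close>

definition indep_rv ::
  "'w measure \<Rightarrow> 'a measure \<Rightarrow> ('w \<Rightarrow> 'a) \<Rightarrow> 'b measure \<Rightarrow> ('w \<Rightarrow> 'b) \<Rightarrow> bool" where
  "indep_rv P N U N' V \<longleftrightarrow>
     U \<in> measurable P N \<and> V \<in> measurable P N' \<and>
     prob_space.indep_set P (sets (vimage_algebra (space P) U N))
                            (sets (vimage_algebra (space P) V N'))"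

definition cond_prob_given :: "'w measure \<Rightarrow> 'w measure \<Rightarrow> 'w set \<Rightarrow> 'w \<Rightarrow> real" where
  "cond_prob_given P F E = real_cond_exp P F (indicator E)"

definition cond_indep_rv ::
  "'w measure \<Rightarrow> 'w measure \<Rightarrow> 'a measure \<Rightarrow> ('w \<Rightarrow> 'a) \<Rightarrow> 'b measure \<Rightarrow> ('w \<Rightarrow> 'b) \<Rightarrow> bool" where
  "cond_indep_rv P F N U N' V \<longleftrightarrow>
     U \<in> measurable P N \<and> V \<in> measurable P N' \<and>
     (\<forall>B\<in>sets N. \<forall>C\<in>sets N'. AE \<omega> in P.
        cond_prob_given P F ((U -` B \<inter> space P) \<inter> (V -` C \<inter> space P)) \<omega> =
        cond_prob_given P F (U -` B \<inter> space P) \<omega> * cond_prob_given P F (V -` C \<inter> space P) \<omega>)"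

text \<open>
  Convergence in probability to a constant.  Measurability is part of the definition, because
  \<^const>\<open>measure\<close> is \<open>0\<close> on non-measurable sets.
\<close>

definition tendsto_in_prob ::
  "'w measure \<Rightarrow> (nat \<Rightarrow> 'w \<Rightarrow> 'b::metric_space) \<Rightarrow> 'b \<Rightarrow> bool" where
  "tendsto_in_prob P Z c \<longleftrightarrow>
     (\<forall>\<^sub>F t in sequentially. Z t \<in> borel_measurable P) \<and>
     (\<forall>\<epsilon>>0. (\<lambda>t. measure P {\<omega> \<in> space P. dist (Z t \<omega>) c > \<epsilon>}) \<longlonglongrightarrow> 0)"

definition outer :: "real^'d \<Rightarrow> real^'d \<Rightarrow> real^'d^'d" where
  "outer u v = (\<chi> i j. u $ i * v $ j)"

definition pos_semidef :: "real^'d^'d \<Rightarrow> bool" where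
  "pos_semidef Q \<longleftrightarrow> transpose Q = Q \<and> (\<forall>v. 0 \<le> v \<bullet> (Q *v v))"

definition loewner_le :: "real^'d^'d \<Rightarrow> real^'d^'d \<Rightarrow> bool" where
  "loewner_le Q R \<longleftrightarrow> pos_semidef (R - Q)"

text \<open>
  Actions form a finite type \<open>'k\<close>, so \<open>K = CARD('k)\<close>; a family \<open>(\<beta>_a)\<close> of vectors
  in \<open>\<real>^d\<close> is an element of \<open>real^'d^'k\<close>, whose norm is the Euclidean norm of \<open>\<real>^(Kd)\<close>.
\<close>

definition prob_simplex :: "(real^'k) set" where
  "prob_simplex = {p. (\<forall>a. 0 \<le> p $ a) \<and> (\<Sum>a\<in>UNIV. p $ a) = 1}"

definition boltzmann :: "real \<Rightarrow> real^'d \<Rightarrow> real^'d^'k \<Rightarrow> real^'k" where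
  "boltzmann \<gamma> x \<beta> =
     (\<chi> a. exp ((\<beta> $ a \<bullet> x) / \<gamma>) / (\<Sum>a'\<in>UNIV. exp ((\<beta> $ a' \<bullet> x) / \<gamma>)))"

definition clip_shift :: "real \<Rightarrow> real^'k \<Rightarrow> real" where
  "clip_shift \<pi>min p = (THE \<nu>. (\<Sum>a\<in>UNIV. max (p $ a - \<nu>) \<pi>min) = 1)"

definition clip :: "real \<Rightarrow> real^'k \<Rightarrow> real^'k" where
  "clip \<pi>min p = (\<chi> a. max (p $ a - clip_shift \<pi>min p) \<pi>min)"

definition clipped_boltzmann :: "real \<Rightarrow> real \<Rightarrow> real^'d \<Rightarrow> real^'d^'k \<Rightarrow> real^'k" where
  "clipped_boltzmann \<pi>min \<gamma> x \<beta> = clip \<pi>min (boltzmann \<gamma> x \<beta>)"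

definition observed :: "(nat \<Rightarrow> 'w \<Rightarrow> 'k) \<Rightarrow> (nat \<Rightarrow> 'w \<Rightarrow> real^'k) \<Rightarrow> nat \<Rightarrow> 'w \<Rightarrow> real" where
  "observed A Ypot t \<omega> = Ypot t \<omega> $ A t \<omega>"

text \<open>
  \<open>history X p A Y t\<close> is the tuple of all rounds \<open>1, \<dots>, t - 1\<close>; here \<open>p \<tau> \<omega>\<close> is the
  vector of action probabilities used in round \<open>\<tau>\<close>.
\<close>

definition history ::
  "(nat \<Rightarrow> 'w \<Rightarrow> real^'d) \<Rightarrow> (nat \<Rightarrow> 'w \<Rightarrow> real^'k) \<Rightarrow> (nat \<Rightarrow> 'w \<Rightarrow> 'k) \<Rightarrow> (nat \<Rightarrow> 'w \<Rightarrow> real) \<Rightarrow>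
   nat \<Rightarrow> 'w \<Rightarrow> nat \<Rightarrow> (real^'d) \<times> (real^'k) \<times> 'k \<times> real" where
  "history X p A Y t \<omega> = (\<lambda>\<tau>\<in>{1..<t}. (X \<tau> \<omega>, p \<tau> \<omega>, A \<tau> \<omega>, Y \<tau> \<omega>))"

definition history_space ::
  "nat \<Rightarrow> (nat \<Rightarrow> (real^'d) \<times> (real^'k) \<times> 'k \<times> real) measure" where
  "history_space t =
     PiM {1..<t} (\<lambda>_. borel \<Otimes>\<^sub>M (borel \<Otimes>\<^sub>M (count_space UNIV \<Otimes>\<^sub>M borel)))"

definition decision_algebra ::
  "'w measure \<Rightarrow> (nat \<Rightarrow> 'w \<Rightarrow> real^'d) \<Rightarrow> (nat \<Rightarrow> 'w \<Rightarrow> real^'k) \<Rightarrow> (nat \<Rightarrow> 'w \<Rightarrow> 'k) \<Rightarrow>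
   (nat \<Rightarrow> 'w \<Rightarrow> real) \<Rightarrow> nat \<Rightarrow> 'w measure" where
  "decision_algebra P X p A Y t =
     vimage_algebra (space P) (\<lambda>\<omega>. (history X p A Y t \<omega>, X t \<omega>)) (history_space t \<Otimes>\<^sub>M borel)"

text \<open>
  Rounds are numbered \<open>1, 2, \<dots>\<close>; index \<open>0\<close> is never used.
\<close>

locale contextual_bandit = prob_space P
  for P :: "'w measure"
    and S :: "(real^'d) set"                          \<comment> \<open>context space\<close>
    and X :: "nat \<Rightarrow> 'w \<Rightarrow> real^'d"                    \<comment> \<open>contexts\<close>
    and Ypot :: "nat \<Rightarrow> 'w \<Rightarrow> real^'k::finite"         \<comment> \<open>potential outcomes\<close>
    and p :: "nat \<Rightarrow> 'w \<Rightarrow> real^'k"                    \<comment> \<open>behavior policy at the current context\<close>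
    and A :: "nat \<Rightarrow> 'w \<Rightarrow> 'k"                         \<comment> \<open>actions\<close> +
  assumes X_in_space: "t \<ge> 1 \<Longrightarrow> \<omega> \<in> space P \<Longrightarrow> X t \<omega> \<in> S"
    and A_measurable: "t \<ge> 1 \<Longrightarrow> A t \<in> measurable P (count_space UNIV)"
    and p_measurable: "t \<ge> 1 \<Longrightarrow> p t \<in> borel_measurable P"
    and tuples_indep: "indep_vars (\<lambda>_. borel) (\<lambda>t \<omega>. (X t \<omega>, Ypot t \<omega>)) {1..}"
    and tuples_ident: "t \<ge> 1 \<Longrightarrow>
          distr P borel (\<lambda>\<omega>. (X t \<omega>, Ypot t \<omega>)) = distr P borel (\<lambda>\<omega>. (X 1 \<omega>, Ypot 1 \<omega>))"
    and tuple_indep_history: "t \<ge> 1 \<Longrightarrow>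
          indep_rv P borel (\<lambda>\<omega>. (X t \<omega>, Ypot t \<omega>))
            (history_space t) (history X p A (observed A Ypot) t)"
    and action_drawn: "t \<ge> 1 \<Longrightarrow>
          AE \<omega> in P. cond_prob_given P (decision_algebra P X p A (observed A Ypot) t)
                        {\<omega>' \<in> space P. A t \<omega>' = a} \<omega> = p t \<omega> $ a"
    and unconfounded: "t \<ge> 1 \<Longrightarrow>
          cond_indep_rv P (decision_algebra P X p A (observed A Ypot) t)
            (count_space UNIV) (A t) borel (Ypot t)"

text \<open>
  Only \<open>y (X t) (A t)\<close> enters the model, so \<open>y\<close> is constrained on the context space \<open>S\<close> alone;
  its measurability there is the usual tacit convention.
\<close>

definition reward_model ::
  "'w measure \<Rightarrow> (real^'d) set \<Rightarrow> (nat \<Rightarrow> 'w \<Rightarrow> real^'d) \<Rightarrow> (nat \<Rightarrow> 'w \<Rightarrow> real^'k) \<Rightarrow>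
   (nat \<Rightarrow> 'w \<Rightarrow> 'k::finite) \<Rightarrow> (nat \<Rightarrow> 'w \<Rightarrow> real) \<Rightarrow>
   (real^'d \<Rightarrow> 'k \<Rightarrow> real) \<Rightarrow> (nat \<Rightarrow> 'w \<Rightarrow> real) \<Rightarrow> real \<Rightarrow> bool" where
  "reward_model P S X p A Y y \<eta> \<sigma>\<eta> \<longleftrightarrow>
     (\<forall>a. (\<lambda>x. y x a) \<in> borel_measurable (restrict_space borel S)) \<and>
     (\<forall>t\<ge>1. AE \<omega> in P. Y t \<omega> = y (X t \<omega>) (A t \<omega>) + \<eta> t \<omega>) \<and>
     prob_space.indep_vars P (\<lambda>_. borel) \<eta> {1..} \<and>
     (\<forall>t\<ge>1. indep_rv P borel (\<eta> t)
        (history_space t \<Otimes>\<^sub>M (borel \<Otimes>\<^sub>M count_space UNIV))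
        (\<lambda>\<omega>. (history X p A Y t \<omega>, X t \<omega>, A t \<omega>))) \<and>
     (\<forall>t\<ge>1. integrable P (\<eta> t) \<and> integral\<^sup>L P (\<eta> t) = 0) \<and>
     (\<forall>t\<ge>1. integrable P (\<lambda>\<omega>. (\<eta> t \<omega>)\<^sup>2) \<and> integral\<^sup>L P (\<lambda>\<omega>. (\<eta> t \<omega>)\<^sup>2) \<le> \<sigma>\<eta>\<^sup>2)"

text \<open>
  The ridge estimator available at the start of round \<open>t\<close>; for \<open>lam > 0\<close> the inverted matrix is
  positive definite.
\<close>

definition ridge ::
  "real \<Rightarrow> (nat \<Rightarrow> 'w \<Rightarrow> real^'d) \<Rightarrow> (nat \<Rightarrow> 'w \<Rightarrow> 'k) \<Rightarrow> (nat \<Rightarrow> 'w \<Rightarrow> real) \<Rightarrow>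
   nat \<Rightarrow> 'w \<Rightarrow> real^'d^'k" where
  "ridge lam X A Y t \<omega> =
     (\<chi> a. matrix_inv
             (mat lam + (\<Sum>\<tau>\<in>{1..<t}. of_bool (A \<tau> \<omega> = a) *\<^sub>R outer (X \<tau> \<omega>) (X \<tau> \<omega>)))
           *v (\<Sum>\<tau>\<in>{1..<t}. of_bool (A \<tau> \<omega> = a) *\<^sub>R (Y \<tau> \<omega> *\<^sub>R X \<tau> \<omega>)))"

end

theory Submission
  imports Defs
begin

text \<open>
  Write \<open>\<Sigma>_a(\<beta>) = E[\<pi>_a(X, \<beta>) X X\<^sup>T]\<close> and \<open>b_a(\<beta>) = E[\<pi>_a(X, \<beta>) y(X, a) X]\<close>.  Clipping makes \<open>\<Sigma>_a(\<beta>)\<close>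
  coercive with constant \<open>\<pi>min \<sigma>min\<^sup>2\<close>, and the clipped softmax is \<open>4M/\<gamma>\<close>-Lipschitz in \<open>\<beta>\<close>, so at high
  temperature \<open>\<beta> \<mapsto> (\<Sigma>_a(\<beta>)\<^sup>-\<^sup>1 b_a(\<beta>))_a\<close> is a contraction with a fixed point \<open>\<theta>\<close>.  The error
  \<open>\<beta>hat_t - \<theta>\<close> is the inverse Gram matrix applied to the sum of the conditional drifts
  \<open>E[\<pi>_a(X, \<beta>hat_\<tau>) (y(X, a) - X \<bullet> \<theta>_a) X]\<close>, which vanish at \<open>\<theta>\<close> and are therefore bounded by earlier errors,
  plus martingale sums of order \<open>sqrt t\<close> in \<open>L\<^sup>2\<close>.  The expected truncated error \<open>u_t\<close> thus satisfies
  \<open>u_t \<le> (1/4) * average of u_1, ..., u_(t-1) + C / sqrt t\<close>, which forces \<open>u_t = O(1 / sqrt t)\<close>.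
\<close>

text \<open>The policy of a round depends on all earlier data, so the summands of the Gram matrix
  are neither independent nor identically distributed. What remains is that, given the past, each
  has mean \<open>\<Sigma>_a(\<beta>hat_\<tau>)\<close>, which is coercive with a constant that does
  not depend on the estimate. A lower bound on the Gram matrix is therefore available without
  knowing where the estimates go. The same product, Lipschitz constant of the policy times size of
  the residual times number of actions, controls both the population map and the recursion for the
  errors. A factor below 1 would give the fixed point, but the rate asks for more: the average of
  \<open>1 / sqrt \<tau>\<close> over \<open>n\<close> rounds is about \<open>2 / sqrt n\<close>, so
  the factor has to be below 1/2. The value 1/4 also pays for passing from \<open>n\<close> to
  \<open>n + 1\<close>. The noise has its own orthogonal sum because it is only square integrable,
  whereas the contributions of contexts and actions are bounded.\<close>

subsection \<open>Clipping and the softmax\<close>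

text \<open>If every shifted entry of \<open>q\<close> exceeded that of \<open>p\<close>, the second
  sum would be strictly larger unless all its terms are cut off at \<open>m\<close>, and then it is
  \<open>CARD('k) * m < 1\<close>. With \<open>p = q\<close> this gives uniqueness of the shift,
  with two vectors its Lipschitz bound.\<close>

lemma clip_levels_comparable:
  fixes p q :: "real^'k::finite"
  assumes "real CARD('k) * m < 1"
    and "(\<Sum>a\<in>UNIV. max (p $ a - \<nu>) m) = 1" "(\<Sum>a\<in>UNIV. max (q $ a - \<nu>') m) = 1"
  shows "\<exists>a. q $ a - \<nu>' \<le> p $ a - \<nu>"
proof (rule ccontr)
  assume "\<not> ?thesis"
  then have less: "p $ a - \<nu> < q $ a - \<nu>'" for a
    by (simp add: not_le)
  have "q $ a - \<nu>' \<le> m" for a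
  proof (rule ccontr)
    assume "\<not> q $ a - \<nu>' \<le> m"
    then have "max (p $ a - \<nu>) m < max (q $ a - \<nu>') m"
      using less[of a] by simp
    moreover have "max (p $ b - \<nu>) m \<le> max (q $ b - \<nu>') m" for b
      using less[of b] by simp
    ultimately have "(\<Sum>a\<in>UNIV. max (p $ a - \<nu>) m) < (\<Sum>a\<in>UNIV. max (q $ a - \<nu>') m)"
      by (intro sum_strict_mono_ex1) auto
    then show False using assms by simp
  qed
  then have "(\<Sum>a\<in>UNIV. max (q $ a - \<nu>') m) = real CARD('k) * m"
    by (simp add: max_def)
  then show False using assms by simp
qed

lemma clip_shift_sum:
  fixes p :: "real^'k::finite"
  assumes m: "0 < m" "real CARD('k) * m < 1"
  shows "(\<Sum>a\<in>UNIV. max (p $ a - clip_shift m p) m) = 1"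
proof -
  let ?f = "\<lambda>\<nu>. \<Sum>a\<in>UNIV. max (p $ a - \<nu>) m"
  \<comment> \<open>At the shift \<open>norm p\<close> every entry is nonpositive and the sum is
    \<open>CARD('k) * m\<close>; at \<open>- norm p - 1\<close> every entry is at least 1.\<close>
  have "\<exists>\<nu>\<ge>- norm p - 1. \<nu> \<le> norm p \<and> ?f \<nu> = 1"
  proof (rule IVT2')
    have "p $ a - norm p \<le> m" for a
      using component_le_norm_cart[of p a] m by linarith
    then have "?f (norm p) = real CARD('k) * m"
      by (simp add: max_def)
    then show "?f (norm p) \<le> 1" using m by simp
    have "1 \<le> max (p $ a - (- norm p - 1)) m" for a
      using component_le_norm_cart[of p a] by linarith
    then have "(\<Sum>a::'k\<in>UNIV. 1) \<le> ?f (- norm p - 1)" by (intro sum_mono)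
    moreover have "1 \<le> (\<Sum>a::'k\<in>UNIV. 1::real)" by (simp add: Suc_leI)
    ultimately show "1 \<le> ?f (- norm p - 1)" by linarith
    show "- norm p - 1 \<le> norm p" using norm_ge_zero[of p] by linarith
    show "continuous_on {- norm p - 1..norm p} ?f" by (intro continuous_intros)
  qed
  then obtain \<nu> where \<nu>: "?f \<nu> = 1" by blast
  show ?thesis unfolding clip_shift_def
  proof (rule theI[where P="\<lambda>\<nu>. ?f \<nu> = 1"])
    show "?f \<nu> = 1" by (rule \<nu>)
    show "\<nu>' = \<nu>" if "?f \<nu>' = 1" for \<nu>'
      using clip_levels_comparable[OF m(2) \<nu> that] clip_levels_comparable[OF m(2) that \<nu>] by auto
  qed
qed

lemma clip_shift_lipschitz:
  fixes p q :: "real^'k::finite"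
  assumes m: "0 < m" "real CARD('k) * m < 1" and d: "\<And>a. \<bar>p $ a - q $ a\<bar> \<le> d"
  shows "\<bar>clip_shift m p - clip_shift m q\<bar> \<le> d"
proof -
  \<comment> \<open>Index \<open>a\<close> bounds \<open>clip_shift m p - clip_shift m q\<close> by
    \<open>p $ a - q $ a\<close>; index \<open>b\<close> bounds the opposite difference.\<close>
  obtain a b where "q $ a - clip_shift m q \<le> p $ a - clip_shift m p"
    and "p $ b - clip_shift m p \<le> q $ b - clip_shift m q"
    using clip_levels_comparable[OF m(2) clip_shift_sum[OF m, of p] clip_shift_sum[OF m, of q]]
      clip_levels_comparable[OF m(2) clip_shift_sum[OF m, of q] clip_shift_sum[OF m, of p]] by blast
  then show ?thesis using d[of a] d[of b] by linarith
qed

text \<open>The entry and the common shift each move by at most \<open>d\<close>, and the cut-off at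
  \<open>m\<close> is nonexpansive.\<close>

lemma clip_lipschitz:
  fixes p q :: "real^'k::finite"
  assumes m: "0 < m" "real CARD('k) * m < 1" and d: "\<And>a. \<bar>p $ a - q $ a\<bar> \<le> d"
  shows "\<bar>clip m p $ a - clip m q $ a\<bar> \<le> 2 * d"
  using clip_shift_lipschitz[OF m d] d[of a] by (simp add: clip_def)

lemma clip_ge: "m \<le> clip m p $ a"
  by (simp add: clip_def)

lemma clip_le_1:
  fixes p :: "real^'k::finite"
  assumes m: "0 < m" "real CARD('k) * m < 1"
  shows "clip m p $ a \<le> 1"
proof -
  have "clip m p $ a \<le> (\<Sum>b\<in>UNIV. clip m p $ b)"
    using clip_ge[of m p] m(1) by (intro member_le_sum) (auto intro: order_trans[OF less_imp_le])
  then show ?thesis using clip_shift_sum[OF m] by (simp add: clip_def)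
qed

lemma clip_in_prob_simplex:
  fixes p :: "real^'k::finite"
  assumes m: "0 < m" "real CARD('k) * m < 1"
  shows "clip m p \<in> prob_simplex"
  using clip_shift_sum[OF m] clip_ge[of m p] m(1)
  by (auto simp: prob_simplex_def clip_def intro: order_trans[OF less_imp_le])

lemma continuous_on_clip:
  fixes f :: "'a::topological_space \<Rightarrow> real^'k::finite"
  assumes m: "0 < m" "real CARD('k) * m < 1" and f: "continuous_on U f"
  shows "continuous_on U (\<lambda>x. clip m (f x))"
proof -
  have shift: "continuous_on UNIV (clip_shift m :: real^'k \<Rightarrow> real)"
  proof (rule continuous_onI)
    fix p :: "real^'k" and e :: real assume "0 < e"
    show "\<exists>d>0. \<forall>p'\<in>UNIV. dist p' p < d \<longrightarrow> dist (clip_shift m p') (clip_shift m p) \<le> e"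
    proof (intro exI[of _ e] conjI ballI impI)
      fix p' assume "dist p' p < e"
      then have "\<bar>p' $ a - p $ a\<bar> \<le> e" for a
        using component_le_norm_cart[of "p' - p" a] by (simp add: dist_norm)
      from clip_shift_lipschitz[OF m this] show "dist (clip_shift m p') (clip_shift m p) \<le> e"
        by (simp add: dist_real_def)
    qed fact
  qed
  show ?thesis unfolding clip_def
    by (intro continuous_intros f continuous_on_compose2[OF shift f]) auto
qed

text \<open>Moving the scores by \<open>d\<close> multiplies numerator and denominator by factors
  between \<open>exp (- d)\<close> and \<open>exp d\<close>, so the ratio shrinks at most by
  \<open>exp (- (2 * d))\<close>. As the ratio is at most 1, it loses at most
  \<open>1 - exp (- (2 * d))\<close>, which is at most \<open>2 * d\<close>.\<close>

lemma softmax_lipschitz: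
  fixes z z' :: "'k::finite \<Rightarrow> real"
  assumes d: "\<And>a. \<bar>z a - z' a\<bar> \<le> d"
  shows "\<bar>exp (z a) / (\<Sum>b\<in>UNIV. exp (z b)) - exp (z' a) / (\<Sum>b\<in>UNIV. exp (z' b))\<bar> \<le> 2 * d"
proof -
  have one_sided: "exp (z a) / (\<Sum>b\<in>UNIV. exp (z b)) - exp (z' a) / (\<Sum>b\<in>UNIV. exp (z' b)) \<le> 2 * d"
    if d: "\<And>a. \<bar>z a - z' a\<bar> \<le> d" for z z' :: "'k \<Rightarrow> real"
  proof -
    let ?s = "\<Sum>b\<in>UNIV. exp (z b)" and ?s' = "\<Sum>b\<in>UNIV. exp (z' b)"
    have pos: "0 < ?s" "0 < ?s'" by (auto intro!: sum_pos)
    have "?s' \<le> exp d * ?s" unfolding sum_distrib_left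
    proof (intro sum_mono)
      show "exp (z' b) \<le> exp d * exp (z b)" for b
        using d[of b] by (simp flip: exp_add)
    qed
    moreover have "exp (- d) * exp (z a) \<le> exp (z' a)"
      using d[of a] by (simp flip: exp_add)
    ultimately have "(exp (- d) * exp (z a)) / (exp d * ?s) \<le> exp (z' a) / ?s'"
      using pos by (intro frac_le) auto
    also have "(exp (- d) * exp (z a)) / (exp d * ?s) = exp (- (2 * d)) * (exp (z a) / ?s)"
      using exp_add[of d d] by (simp add: exp_minus field_simps)
    finally have "exp (z a) / ?s - exp (z' a) / ?s' \<le> (1 - exp (- (2 * d))) * (exp (z a) / ?s)"
      by (simp only: left_diff_distrib)
    also have "\<dots> \<le> (1 - exp (- (2 * d))) * 1"
    proof (rule mult_left_mono)
      have "exp (z a) \<le> ?s" by (intro member_le_sum) auto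
      then show "exp (z a) / ?s \<le> 1" using pos by simp
      show "0 \<le> 1 - exp (- (2 * d))" using d[of a] by simp
    qed
    also have "\<dots> \<le> 2 * d" using exp_ge_add_one_self[of "- (2 * d)"] by simp
    finally show ?thesis .
  qed
  have d': "\<And>a. \<bar>z' a - z a\<bar> \<le> d"
    using d by (simp add: abs_minus_commute)
  show ?thesis
    unfolding abs_le_iff minus_diff_eq
    using one_sided[of z z', OF d] one_sided[of z' z, OF d'] by (rule conjI)
qed

text \<open>The scores move by \<open>M / \<gamma> * d\<close>; softmax and clipping each cost a
  factor 2. Because \<open>d\<close> bounds every block separately, the constant does not grow with
  the number of actions.\<close>

lemma clipped_boltzmann_lipschitz:
  fixes \<beta> \<beta>' :: "real^'d^'k::finite"
  assumes m: "0 < m" "real CARD('k) * m < 1" and "0 < \<gamma>" and "norm x \<le> M"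
    and d: "\<And>a. norm (\<beta> $ a - \<beta>' $ a) \<le> d"
  shows "\<bar>clipped_boltzmann m \<gamma> x \<beta> $ a - clipped_boltzmann m \<gamma> x \<beta>' $ a\<bar> \<le> 4 * M / \<gamma> * d"
proof -
  have "\<bar>(\<beta> $ a \<bullet> x) / \<gamma> - (\<beta>' $ a \<bullet> x) / \<gamma>\<bar> \<le> M / \<gamma> * d" for a
  proof -
    have "\<bar>(\<beta> $ a - \<beta>' $ a) \<bullet> x\<bar> \<le> d * M"
      using Cauchy_Schwarz_ineq2[of "\<beta> $ a - \<beta>' $ a" x]
        mult_mono[OF d[of a] \<open>norm x \<le> M\<close>] order_trans[OF norm_ge_zero d[of a]] by simp
    then show ?thesis using \<open>0 < \<gamma>\<close>
      by (simp add: inner_diff_left diff_divide_distrib[symmetric] field_simps)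
  qed
  from softmax_lipschitz[OF this]
  have "\<bar>boltzmann \<gamma> x \<beta> $ a - boltzmann \<gamma> x \<beta>' $ a\<bar> \<le> 2 * (M / \<gamma> * d)" for a
    by (simp add: boltzmann_def)
  from clip_lipschitz[OF m this, of a] show ?thesis by (simp add: clipped_boltzmann_def mult.assoc)
qed

text \<open>Joint continuity in context and parameter is the source of the joint measurability that
  the Fubini arguments rest on.\<close>

lemma continuous_on_clipped_boltzmann:
  assumes m: "0 < m" "real CARD('k::finite) * m < 1" and "0 < \<gamma>"
  shows "continuous_on UNIV (\<lambda>z. clipped_boltzmann m \<gamma> (fst z) (snd z :: real^'d^'k))"
  unfolding clipped_boltzmann_def boltzmann_def
proof (intro continuous_on_clip[OF m] continuous_intros ballI)
  have "0 < (\<Sum>a\<in>UNIV. exp (snd z $ a \<bullet> fst z / \<gamma>))" for z :: "(real^'d) \<times> (real^'d^'k)"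
    by (intro sum_pos) auto
  then show "(\<Sum>a\<in>UNIV. exp (snd z $ a \<bullet> fst z / \<gamma>)) \<noteq> 0" for z :: "(real^'d) \<times> (real^'d^'k)"
    by (metis less_irrefl)
qed (use \<open>0 < \<gamma>\<close> in auto)

subsection \<open>Matrices\<close>

lemma mat_mult_vec: "mat c *v v = c *\<^sub>R v" for v :: "real^'n"
  by (simp add: vec_eq_iff matrix_vector_mult_def mat_def mult_delta_left)

lemma outer_mult_vec: "outer x y *v w = (y \<bullet> w) *\<^sub>R x"
  by (simp add: vec_eq_iff outer_def matrix_vector_mult_def inner_vec_def sum_distrib_left mult_ac)

lemma norm_outer_self: "norm (outer x x) = (norm x)\<^sup>2"
proof -
  have "outer x x $ i = (x $ i) *\<^sub>R x" for i
    by (simp add: vec_eq_iff outer_def)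
  then have "norm (outer x x) = L2_set (\<lambda>i. norm x * norm (x $ i)) UNIV"
    by (simp add: norm_vec_def[of "outer x x"] mult.commute)
  also have "\<dots> = norm x * L2_set (\<lambda>i. norm (x $ i)) UNIV"
    by (rule L2_set_right_distrib[symmetric]) simp
  also have "L2_set (\<lambda>i. norm (x $ i)) UNIV = norm x"
    by (simp only: norm_vec_def)
  finally show ?thesis by (simp only: power2_eq_square)
qed

text \<open>\<open>norm Q\<close> is the Frobenius norm, so Cauchy-Schwarz in each row
  suffices.\<close>

lemma norm_matrix_vector_le: "norm (Q *v w) \<le> norm Q * norm w" for Q :: "real^'n^'m"
proof -
  have "norm (Q *v w) \<le> L2_set (\<lambda>i. norm w * norm (Q $ i)) UNIV"
    unfolding norm_vec_def[of "Q *v w"]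
    by (intro L2_set_mono)
       (auto simp: matrix_vector_mul_component mult.commute[of "norm w"] Cauchy_Schwarz_ineq2)
  then show ?thesis
    by (simp add: norm_vec_def[of Q] L2_set_right_distrib mult.commute)
qed

text \<open>Cauchy-Schwarz, then cancel one \<open>norm v\<close>. The sign of \<open>c\<close> is
  free and the hypothesis concerns this one \<open>v\<close>: in
  \<open>truncated_error_bound\<close> the constant is random and may be negative.\<close>

lemma coercive_norm_le:
  fixes Q :: "real^'n^'n"
  assumes "c * (norm v)\<^sup>2 \<le> v \<bullet> (Q *v v)"
  shows "c * norm v \<le> norm (Q *v v)"
proof (cases "v = 0")
  case False
  have "c * norm v * norm v \<le> norm (Q *v v) * norm v"
    using assms norm_cauchy_schwarz[of v "Q *v v"] by (simp add: power2_eq_square mult_ac)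
  with False show ?thesis by simp
qed simp

lemma coercive_invertible:
  fixes Q :: "real^'n^'n"
  assumes "0 < c" and Q: "\<And>v. c * (norm v)\<^sup>2 \<le> v \<bullet> (Q *v v)"
  shows "invertible Q"
proof -
  have "v = 0" if "Q *v v = 0" for v
    using coercive_norm_le[OF Q, of v] that \<open>0 < c\<close> by (simp add: mult_le_0_iff)
  then show ?thesis
    using invertible_left_inverse matrix_left_invertible_ker by blast
qed

lemma matrix_inv_solves:
  fixes Q :: "real^'n^'n"
  assumes "invertible Q"
  shows "Q *v (matrix_inv Q *v b) = b"
proof -
  have "Q ** matrix_inv Q = mat 1"
    using assms unfolding invertible_def matrix_inv_def by (metis (mono_tags, lifting) someI_ex)
  then show ?thesis by (simp add: matrix_vector_mul_assoc)
qed

section \<open>Measurability of vectors, determinants and solutions of linear systems\<close>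

lemma borel_measurable_vecI:
  fixes f :: "'w \<Rightarrow> ('b::euclidean_space)^'n::finite"
  assumes "\<And>i. (\<lambda>\<omega>. f \<omega> $ i) \<in> borel_measurable N"
  shows "f \<in> borel_measurable N"
proof -
  have "(\<lambda>\<omega>. f \<omega> \<bullet> axis i b) \<in> borel_measurable N" for i b
    unfolding inner_axis by (intro borel_measurable_inner assms borel_measurable_const)
  then show ?thesis
    by (subst borel_measurable_euclidean_space) (auto simp: Basis_vec_def)
qed

lemma borel_measurable_vec_nth:
  fixes f :: "'w \<Rightarrow> ('b::euclidean_space)^'n::finite"
  assumes "f \<in> borel_measurable N"
  shows "(\<lambda>\<omega>. f \<omega> $ i) \<in> borel_measurable N"
  by (rule borel_measurable_continuous_on[OF _ assms]) (intro continuous_intros)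

lemma borel_measurable_det:
  fixes Q :: "'w \<Rightarrow> real^'n^'n"
  assumes "\<And>i j. (\<lambda>\<omega>. Q \<omega> $ i $ j) \<in> borel_measurable N"
  shows "(\<lambda>\<omega>. det (Q \<omega>)) \<in> borel_measurable N"
  unfolding det_def
  by (intro borel_measurable_sum borel_measurable_times borel_measurable_prod borel_measurable_const assms)

text \<open>\<open>matrix_inv\<close> is defined by choice, which hides its measurability. Cramer's
  rule writes the solution with determinants, and these are polynomials in the entries.\<close>

lemma borel_measurable_matrix_inv_mult:
  fixes Q :: "'w \<Rightarrow> real^'n^'n" and b :: "'w \<Rightarrow> real^'n"
  assumes Q: "Q \<in> borel_measurable N" and b: "b \<in> borel_measurable N"
    and inv: "\<And>\<omega>. \<omega> \<in> space N \<Longrightarrow> invertible (Q \<omega>)"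
  shows "(\<lambda>\<omega>. matrix_inv (Q \<omega>) *v b \<omega>) \<in> borel_measurable N"
proof -
  have entries: "(\<lambda>\<omega>. Q \<omega> $ i $ j) \<in> borel_measurable N" "(\<lambda>\<omega>. b \<omega> $ i) \<in> borel_measurable N" for i j
    by (intro borel_measurable_vec_nth Q b)+
  have "(\<lambda>\<omega>. \<chi> k. det (\<chi> i j. if j = k then b \<omega> $ i else Q \<omega> $ i $ j) / det (Q \<omega>)) \<in> borel_measurable N"
  proof (intro borel_measurable_vecI)
    fix k
    have "(\<lambda>\<omega>. (\<chi> i j. if j = k then b \<omega> $ i else Q \<omega> $ i $ j) $ i $ j) \<in> borel_measurable N" for i j
      using entries by (cases "j = k") auto
    from borel_measurable_det[OF this] borel_measurable_det[OF entries(1)]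
    show "(\<lambda>\<omega>. (\<chi> k. det (\<chi> i j. if j = k then b \<omega> $ i else Q \<omega> $ i $ j) / det (Q \<omega>)) $ k) \<in> borel_measurable N"
      by simp
  qed
  then show ?thesis
  proof (rule measurable_cong[THEN iffD1, rotated])
    fix \<omega> assume "\<omega> \<in> space N"
    then have "invertible (Q \<omega>)" by (rule inv)
    then have "det (Q \<omega>) \<noteq> 0" "Q \<omega> *v (matrix_inv (Q \<omega>) *v b \<omega>) = b \<omega>"
      by (simp_all only: invertible_det_nz matrix_inv_solves not_False_eq_True)
    from cramer[OF this(1), THEN iffD1, OF this(2)]
    show "(\<chi> k. det (\<chi> i j. if j = k then b \<omega> $ i else Q \<omega> $ i $ j) / det (Q \<omega>)) = matrix_inv (Q \<omega>) *v b \<omega>"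
      by (rule sym)
  qed
qed

subsection \<open>Independence and orthogonal sums\<close>

text \<open>Independence is taken between sigma-algebras, so \<open>U\<close> and \<open>V\<close>
  may have different value types and may be any variables measurable with respect to
  \<open>F\<close> and \<open>G\<close>. The product rule on rectangles determines the joint
  law.\<close>

lemma (in prob_space) distr_pair_indep_set:
  assumes indep: "indep_set (sets F) (sets G)"
    and U: "U \<in> measurable F N" and V: "V \<in> measurable G N'"
    and space: "space F = space M" "space G = space M"
  shows "distr M (N \<Otimes>\<^sub>M N') (\<lambda>\<omega>. (U \<omega>, V \<omega>)) = distr M N U \<Otimes>\<^sub>M distr M N' V"
proof -
  have F: "sets F \<subseteq> events" and G: "sets G \<subseteq> events"
    using indep_setD_ev1[OF indep] indep_setD_ev2[OF indep] by auto
  have U': "U \<in> measurable M N" and V': "V \<in> measurable M N'"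
    using measurable_from_subalg[of M F U N] measurable_from_subalg[of M G V N'] U V F G space
    by (auto simp: subalgebra_def)
  interpret U: prob_space "distr M N U" using U' by (rule prob_space_distr)
  interpret V: prob_space "distr M N' V" using V' by (rule prob_space_distr)
  show ?thesis
  proof (rule pair_measure_eqI[symmetric])
    fix B C assume BC: "B \<in> sets (distr M N U)" "C \<in> sets (distr M N' V)"
    let ?B = "U -` B \<inter> space M" and ?C = "V -` C \<inter> space M"
    have "?B \<in> sets F" "?C \<in> sets G"
      using BC measurable_sets[OF U, of B] measurable_sets[OF V, of C] space by auto
    then have "prob (?B \<inter> ?C) = prob ?B * prob ?C" by (rule indep_setD[OF indep])
    moreover have "(\<lambda>\<omega>. (U \<omega>, V \<omega>)) -` (B \<times> C) \<inter> space M = ?B \<inter> ?C"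
      by auto
    moreover have "emeasure (distr M N U) B = prob ?B" "emeasure (distr M N' V) C = prob ?C"
      using BC U' V' by (simp_all add: emeasure_distr emeasure_eq_measure)
    moreover have "emeasure (distr M (N \<Otimes>\<^sub>M N') (\<lambda>\<omega>. (U \<omega>, V \<omega>))) (B \<times> C)
        = prob ((\<lambda>\<omega>. (U \<omega>, V \<omega>)) -` (B \<times> C) \<inter> space M)"
      using BC measurable_Pair[OF U' V'] by (simp add: emeasure_distr emeasure_eq_measure)
    ultimately show "emeasure (distr M N U) B * emeasure (distr M N' V) C
        = emeasure (distr M (N \<Otimes>\<^sub>M N') (\<lambda>\<omega>. (U \<omega>, V \<omega>))) (B \<times> C)"
      by (simp only: ennreal_mult measure_nonneg)
  next
    show "sets (distr M N U \<Otimes>\<^sub>M distr M N' V) = sets (distr M (N \<Otimes>\<^sub>M N') (\<lambda>\<omega>. (U \<omega>, V \<omega>)))"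
      unfolding sets_distr by (intro sets_pair_measure_cong) (simp_all only: sets_distr)
  qed (rule U.sigma_finite_measure_axioms V.sigma_finite_measure_axioms)+
qed

text \<open>The freezing rule: under the product law, Fubini integrates out \<open>U\<close> while
  \<open>V\<close> is held fixed.\<close>

lemma (in prob_space) integral_indep_set:
  fixes f :: "_ \<Rightarrow> 'b::{banach, second_countable_topology}"
  assumes indep: "indep_set (sets F) (sets G)"
    and U: "U \<in> measurable F N" and V: "V \<in> measurable G N'"
    and space: "space F = space M" "space G = space M"
    and f: "f \<in> borel_measurable (N \<Otimes>\<^sub>M N')"
    and int: "integrable M (\<lambda>\<omega>. f (U \<omega>, V \<omega>))"
  shows "(\<integral>\<omega>. f (U \<omega>, V \<omega>) \<partial>M) = (\<integral>\<omega>. (\<integral>u. f (u, V \<omega>) \<partial>distr M N U) \<partial>M)"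
proof -
  have F: "sets F \<subseteq> events" and G: "sets G \<subseteq> events"
    using indep_setD_ev1[OF indep] indep_setD_ev2[OF indep] by auto
  have U': "U \<in> measurable M N" and V': "V \<in> measurable M N'"
    using measurable_from_subalg[of M F U N] measurable_from_subalg[of M G V N'] U V F G space
    by (auto simp: subalgebra_def)
  note eq = distr_pair_indep_set[OF indep U V space]
  interpret U: prob_space "distr M N U" using U' by (rule prob_space_distr)
  interpret V: prob_space "distr M N' V" using V' by (rule prob_space_distr)
  interpret pair_sigma_finite "distr M N U" "distr M N' V" ..
  have pair: "(\<lambda>\<omega>. (U \<omega>, V \<omega>)) \<in> measurable M (N \<Otimes>\<^sub>M N')" using U' V' by (rule measurable_Pair)
  have int': "integrable (distr M N U \<Otimes>\<^sub>M distr M N' V) f"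
    unfolding eq[symmetric] using int f pair by (simp add: integrable_distr_eq)
  have "(\<integral>\<omega>. f (U \<omega>, V \<omega>) \<partial>M) = integral\<^sup>L (distr M N U \<Otimes>\<^sub>M distr M N' V) f"
    unfolding eq[symmetric] using f pair by (simp add: integral_distr)
  also have "\<dots> = (\<integral>v. (\<integral>u. f (u, v) \<partial>distr M N U) \<partial>distr M N' V)"
    using integral_snd[of "\<lambda>u v. f (u, v)"] int' by simp
  also have "\<dots> = (\<integral>\<omega>. (\<integral>u. f (u, V \<omega>) \<partial>distr M N U) \<partial>M)"
  proof (rule integral_distr[OF V'])
    have "(\<lambda>(v, u). f (u, v)) \<in> borel_measurable (N' \<Otimes>\<^sub>M distr M N U)"
      using measurable_compose[OF measurable_pair_swap' f] by (simp add: case_prod_beta' cong: measurable_cong_sets)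
    then show "(\<lambda>v. \<integral>u. f (u, v) \<partial>distr M N U) \<in> borel_measurable N'"
      by (rule U.borel_measurable_lebesgue_integral)
  qed
  finally show ?thesis .
qed

lemma (in prob_space) integral_le_sqrt:
  fixes f :: "'a \<Rightarrow> real"
  assumes "f \<in> borel_measurable M" "integrable M (\<lambda>\<omega>. (f \<omega>)\<^sup>2)" "(\<integral>\<omega>. (f \<omega>)\<^sup>2 \<partial>M) \<le> V"
  shows "integrable M f" "(\<integral>\<omega>. f \<omega> \<partial>M) \<le> sqrt V"
proof -
  show int: "integrable M f"
    using assms(1,2) by (rule square_integrable_imp_integrable)
  have "0 \<le> variance f" by simp
  then have "(expectation f)\<^sup>2 \<le> V"
    using variance_eq[OF int assms(2)] assms(3) by simp
  then show "(\<integral>\<omega>. f \<omega> \<partial>M) \<le> sqrt V"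
    by (rule real_le_rsqrt)
qed

lemma integrable_inner_of_square:
  fixes f g :: "'a \<Rightarrow> 'b::euclidean_space"
  assumes [measurable]: "f \<in> borel_measurable M" "g \<in> borel_measurable M"
    and "integrable M (\<lambda>\<omega>. (norm (f \<omega>))\<^sup>2)" "integrable M (\<lambda>\<omega>. (norm (g \<omega>))\<^sup>2)"
  shows "integrable M (\<lambda>\<omega>. f \<omega> \<bullet> g \<omega>)"
proof (rule Bochner_Integration.integrable_bound)
  show "integrable M (\<lambda>\<omega>. (norm (f \<omega>))\<^sup>2 + (norm (g \<omega>))\<^sup>2)" using assms by simp
  have "\<bar>f \<omega> \<bullet> g \<omega>\<bar> \<le> (norm (f \<omega>))\<^sup>2 + (norm (g \<omega>))\<^sup>2" for \<omega>
    using Cauchy_Schwarz_ineq2[of "f \<omega>" "g \<omega>"] sum_squares_bound[of "norm (f \<omega>)" "norm (g \<omega>)"]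
      mult_nonneg_nonneg[OF norm_ge_zero norm_ge_zero, of "f \<omega>" "g \<omega>"] by linarith
  then show "AE \<omega> in M. norm (f \<omega> \<bullet> g \<omega>) \<le> norm ((norm (f \<omega>))\<^sup>2 + (norm (g \<omega>))\<^sup>2)" by simp
qed simp

text \<open>Without cross terms the second moments add up, and nonnegativity of the variance passes
  from the second moment to the expected norm. Orthogonality is asked for \<open>i < j\<close> only,
  the form in which the later term is centered given the earlier one.\<close>

lemma (in prob_space) orthogonal_sum_bound:
  fixes D :: "nat \<Rightarrow> 'a \<Rightarrow> 'b::euclidean_space"
  assumes "finite I" and D: "\<And>i. i \<in> I \<Longrightarrow> D i \<in> borel_measurable M"
    and sq: "\<And>i. i \<in> I \<Longrightarrow> integrable M (\<lambda>\<omega>. (norm (D i \<omega>))\<^sup>2)"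
    and V: "\<And>i. i \<in> I \<Longrightarrow> (\<integral>\<omega>. (norm (D i \<omega>))\<^sup>2 \<partial>M) \<le> V"
    and orth: "\<And>i j. i \<in> I \<Longrightarrow> j \<in> I \<Longrightarrow> i < j \<Longrightarrow> (\<integral>\<omega>. D i \<omega> \<bullet> D j \<omega> \<partial>M) = 0"
  shows "integrable M (\<lambda>\<omega>. norm (\<Sum>i\<in>I. D i \<omega>))"
    "(\<integral>\<omega>. norm (\<Sum>i\<in>I. D i \<omega>) \<partial>M) \<le> sqrt (real (card I) * V)"
proof -
  have eq: "(norm (\<Sum>i\<in>I. D i \<omega>))\<^sup>2 = (\<Sum>i\<in>I. \<Sum>j\<in>I. D i \<omega> \<bullet> D j \<omega>)" for \<omega>
    by (simp add: power2_norm_eq_inner inner_sum_left inner_sum_right) (rule sum.swap)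
  have int: "integrable M (\<lambda>\<omega>. D i \<omega> \<bullet> D j \<omega>)" if "i \<in> I" "j \<in> I" for i j
    using that by (intro integrable_inner_of_square D sq)
  have orth': "(\<integral>\<omega>. D i \<omega> \<bullet> D j \<omega> \<partial>M) = 0" if "i \<in> I" "j \<in> I" "i \<noteq> j" for i j
    using orth[of i j] orth[of j i] that by (cases "i < j") (auto simp: inner_commute)
  have "(\<integral>\<omega>. (norm (\<Sum>i\<in>I. D i \<omega>))\<^sup>2 \<partial>M) = (\<Sum>i\<in>I. \<Sum>j\<in>I. \<integral>\<omega>. D i \<omega> \<bullet> D j \<omega> \<partial>M)"
    unfolding eq by (simp add: int Bochner_Integration.integral_sum Bochner_Integration.integrable_sum)
  also have "\<dots> = (\<Sum>i\<in>I. \<integral>\<omega>. D i \<omega> \<bullet> D i \<omega> \<partial>M)"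
  proof (rule sum.cong[OF refl])
    fix i assume "i \<in> I"
    then have "(\<Sum>j\<in>I. \<integral>\<omega>. D i \<omega> \<bullet> D j \<omega> \<partial>M) = (\<Sum>j\<in>I. if j = i then \<integral>\<omega>. D i \<omega> \<bullet> D i \<omega> \<partial>M else 0)"
      by (intro sum.cong) (auto simp: orth')
    with \<open>finite I\<close> \<open>i \<in> I\<close> show "(\<Sum>j\<in>I. \<integral>\<omega>. D i \<omega> \<bullet> D j \<omega> \<partial>M) = (\<integral>\<omega>. D i \<omega> \<bullet> D i \<omega> \<partial>M)" by simp
  qed
  also have "\<dots> \<le> real (card I) * V"
    using V by (intro sum_bounded_above) (simp add: power2_norm_eq_inner)
  finally have le: "(\<integral>\<omega>. (norm (\<Sum>i\<in>I. D i \<omega>))\<^sup>2 \<partial>M) \<le> real (card I) * V" .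
  have meas: "(\<lambda>\<omega>. norm (\<Sum>i\<in>I. D i \<omega>)) \<in> borel_measurable M"
    using borel_measurable_sum[of I D M] D by simp
  have sqint: "integrable M (\<lambda>\<omega>. (norm (\<Sum>i\<in>I. D i \<omega>))\<^sup>2)"
    unfolding eq by (intro Bochner_Integration.integrable_sum int)
  show "integrable M (\<lambda>\<omega>. norm (\<Sum>i\<in>I. D i \<omega>))"
    "(\<integral>\<omega>. norm (\<Sum>i\<in>I. D i \<omega>) \<partial>M) \<le> sqrt (real (card I) * V)"
    using integral_le_sqrt[OF meas sqint le] by auto
qed

section \<open>Decay of a sequence bounded by a fraction of its own average\<close>

lemma sum_inverse_sqrt_le: "(\<Sum>\<tau>\<in>{1..<t}. 1 / sqrt (real \<tau>)) \<le> 2 * sqrt (real (t - 1))"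
proof (induction t)
  case (Suc t)
  show ?case
  proof (cases "t = 0")
    case False
    let ?s = "sqrt (real t)" and ?r = "sqrt (real (t - 1))"
    have s: "0 < ?s" "?s * ?s = real t" "?r * ?r = real t - 1" "0 \<le> ?r"
      using False by (auto simp: of_nat_diff)
    \<comment> \<open>Since \<open>?s * ?s + ?r * ?r = 2 * t - 1\<close>, this square is what makes
      \<open>1 / ?s\<close> at most the telescoping increment
      \<open>2 * ?s - 2 * ?r\<close>.\<close>
    have "0 \<le> (?s - ?r)\<^sup>2" by simp
    then have "1 \<le> (2 * ?s - 2 * ?r) * ?s"
      using s(2,3) unfolding power2_eq_square by (simp only: algebra_simps)
    then have "1 / ?s \<le> 2 * ?s - 2 * ?r"
      using s(1) by (simp add: pos_divide_le_eq)
    moreover have "(\<Sum>\<tau>\<in>{1..<Suc t}. 1 / sqrt (real \<tau>)) = (\<Sum>\<tau>\<in>{1..<t}. 1 / sqrt (real \<tau>)) + 1 / ?s"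
      using False by (intro sum.atLeastLessThan_Suc) auto
    ultimately show ?thesis using Suc by simp
  qed simp
qed simp

text \<open>Put \<open>D = B + 5 * C\<close>. If the claim holds before \<open>t\<close>, the sum is
  at most \<open>2 * D * sqrt n\<close> with \<open>n = t - 1\<close>, so the recursion yields
  \<open>(D / 2 + C) / sqrt n\<close>. It remains to replace \<open>n\<close> by \<open>t\<close>,
  for which the factor 1/4 has left room. The summand \<open>B\<close> covers
  \<open>t = 1\<close>.\<close>

lemma averaged_recursion_decay:
  fixes u :: "nat \<Rightarrow> real"
  assumes bound: "\<And>t. 1 \<le> t \<Longrightarrow> u t \<le> B" and "0 \<le> B" "0 \<le> C"
    and rec: "\<And>t. 2 \<le> t \<Longrightarrow> u t \<le> (\<Sum>\<tau>\<in>{1..<t}. u \<tau>) / (4 * real (t - 1)) + C / sqrt (real (t - 1))"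
    and "1 \<le> t"
  shows "u t \<le> (B + 5 * C) / sqrt (real t)"
  using \<open>1 \<le> t\<close>
proof (induction t rule: less_induct)
  case (less t)
  let ?D = "B + 5 * C"
  show ?case
  proof (cases "t = 1")
    case True
    then show ?thesis using bound[of 1] \<open>0 \<le> C\<close> by simp
  next
    case False
    with less.prems have t: "2 \<le> t" by simp
    define n where "n = t - 1"
    have n: "1 \<le> n" "t = Suc n" using t by (auto simp: n_def)
    have D: "0 \<le> ?D" using \<open>0 \<le> B\<close> \<open>0 \<le> C\<close> by simp
    have "(\<Sum>\<tau>\<in>{1..<t}. u \<tau>) \<le> (\<Sum>\<tau>\<in>{1..<t}. ?D * (1 / sqrt (real \<tau>)))"
      using less.IH by (intro sum_mono) auto
    also have "\<dots> \<le> ?D * (2 * sqrt (real n))"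
      unfolding sum_distrib_left[symmetric] n_def using sum_inverse_sqrt_le D by (intro mult_left_mono)
    finally have "(\<Sum>\<tau>\<in>{1..<t}. u \<tau>) / (4 * real n) \<le> ?D * (2 * sqrt (real n)) / (4 * real n)"
      by (intro divide_right_mono) auto
    also have "\<dots> = ?D / 2 / sqrt (real n)"
      
    proof -
      have "real n = sqrt (real n) * sqrt (real n)" by simp
      then have "?D * (2 * sqrt (real n)) / (4 * real n) = ?D * (2 * sqrt (real n)) / (4 * (sqrt (real n) * sqrt (real n)))"
        by (rule arg_cong)
      also have "\<dots> = ?D / 2 / sqrt (real n)" using n by (simp add: field_simps del: real_sqrt_mult_self)
      finally show ?thesis .
    qed
    finally have u: "u t \<le> (?D / 2 + C) / sqrt (real n)"
      using rec[OF t] by (simp add: n_def add_divide_distrib)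
    \<comment> \<open>Here \<open>t \<le> 2 * n\<close>, and 10/7 is a rational slightly above the
      square root of 2. The inequality \<open>(D / 2 + C) * (10 / 7) \<le> D\<close> amounts to
      \<open>5 * C \<le> D\<close>, which is where the 5 comes from.\<close>
    have "sqrt (real t) \<le> sqrt ((10 / 7)\<^sup>2 * real n)"
      using n by (simp add: power2_eq_square)
    then have "sqrt (real t) \<le> 10 / 7 * sqrt (real n)" by (simp add: real_sqrt_mult)
    then have "(?D / 2 + C) * sqrt (real t) \<le> (?D / 2 + C) * (10 / 7 * sqrt (real n))"
      using \<open>0 \<le> C\<close> D by (intro mult_left_mono) auto
    also have "\<dots> = (?D / 2 + C) * (10 / 7) * sqrt (real n)" by simp
    also have "\<dots> \<le> ?D * sqrt (real n)"
      using \<open>0 \<le> B\<close> \<open>0 \<le> C\<close> by (intro mult_right_mono) auto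
    finally have "(?D / 2 + C) / sqrt (real n) \<le> ?D / sqrt (real t)"
      using n by (simp add: field_simps)
    with u show ?thesis by linarith
  qed
qed

section \<open>The bandit driven by ridge estimates\<close>

locale ridge_bandit = contextual_bandit P S X Ypot p A
  for P :: "'w measure" and S :: "(real^'d) set" and X :: "nat \<Rightarrow> 'w \<Rightarrow> real^'d"
    and Ypot :: "nat \<Rightarrow> 'w \<Rightarrow> real^'k" and p :: "nat \<Rightarrow> 'w \<Rightarrow> real^'k" and A :: "nat \<Rightarrow> 'w \<Rightarrow> 'k" +
  fixes y :: "real^'d \<Rightarrow> 'k \<Rightarrow> real" and \<eta> :: "nat \<Rightarrow> 'w \<Rightarrow> real"
    and M \<sigma>min Ry \<sigma>\<eta> \<pi>min \<gamma> lam :: real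
  assumes \<pi>min: "0 < \<pi>min" "real CARD('k) * \<pi>min < 1"
    and pos: "0 < M" "0 < \<sigma>min" "0 < Ry" "0 < \<sigma>\<eta>" "0 < \<gamma>" "0 < lam"
    and X_bounded: "\<And>t. t \<ge> 1 \<Longrightarrow> AE \<omega> in P. norm (X t \<omega>) \<le> M"
    and X_cov: "loewner_le (mat (\<sigma>min\<^sup>2)) (integral\<^sup>L P (\<lambda>\<omega>. outer (X 1 \<omega>) (X 1 \<omega>)))"
    and reward: "reward_model P S X p A (observed A Ypot) y \<eta> \<sigma>\<eta>"
    and y_bounded: "\<And>x a. x \<in> S \<Longrightarrow> norm x \<le> M \<Longrightarrow> \<bar>y x a\<bar> \<le> Ry"
    and behavior: "\<And>t \<omega>. t \<ge> 1 \<Longrightarrow> \<omega> \<in> space P \<Longrightarrow>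
          p t \<omega> = clipped_boltzmann \<pi>min \<gamma> (X t \<omega>) (ridge lam X A (observed A Ypot) t \<omega>)"
    and temperature: "32 * M^4 * Ry * real CARD('k) \<le> \<gamma> * (\<pi>min * \<sigma>min\<^sup>2)\<^sup>2"
begin

abbreviation Y :: "nat \<Rightarrow> 'w \<Rightarrow> real" where
  "Y \<equiv> observed A Ypot"

abbreviation \<beta>hat :: "nat \<Rightarrow> 'w \<Rightarrow> real^'d^'k" where
  "\<beta>hat \<equiv> ridge lam X A Y"

abbreviation policy :: "real^'d \<Rightarrow> real^'d^'k \<Rightarrow> real^'k" where
  "policy \<equiv> clipped_boltzmann \<pi>min \<gamma>"

text \<open>Measurability of \<open>y\<close> is given on \<open>S\<close> alone, so contexts are
  random elements of \<open>S\<close> with the trace of the Borel sets; \<open>S\<close> may be any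
  set, since every \<open>X t\<close> maps into it.\<close>

definition context_algebra :: "(real^'d) measure" where
  "context_algebra = restrict_space borel S"

definition context_law :: "(real^'d) measure" where
  "context_law = distr P context_algebra (X 1)"

text \<open>Generated by the rounds before \<open>t\<close>. The context \<open>X t\<close> is
  independent of it, in contrast to \<open>decision_algebra\<close>, which contains
  \<open>X t\<close>.\<close>

definition past :: "nat \<Rightarrow> 'w measure" where
  "past t = vimage_algebra (space P) (history X p A Y t) (history_space t)"

text \<open>The conditional mean of \<open>1_{A = a} \<phi>(X)\<close> in a round whose estimate is
  \<open>\<beta>\<close>. It is \<open>\<Sigma>_a(\<beta>)\<close> for \<open>second_moment\<close>
  and \<open>b_a(\<beta>)\<close> for \<open>residual a 0\<close>; leaving \<open>\<phi>\<close>
  open lets one martingale argument serve matrices and vectors.\<close>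

definition drift :: "'k \<Rightarrow> (real^'d \<Rightarrow> 'b::euclidean_space) \<Rightarrow> real^'d^'k \<Rightarrow> 'b" where
  "drift a \<phi> \<beta> = (\<integral>x. (policy x \<beta> $ a) *\<^sub>R \<phi> x \<partial>context_law)"

subsection \<open>Measurability with respect to the past\<close>

lemma measurable_contextD: "f \<in> measurable borel N \<Longrightarrow> f \<in> measurable context_algebra N"
  unfolding context_algebra_def by (rule measurable_restrict_space1)

lemma tuple_measurable: "t \<ge> 1 \<Longrightarrow> (\<lambda>\<omega>. (X t \<omega>, Ypot t \<omega>)) \<in> borel_measurable P"
  using tuples_indep unfolding indep_vars_def2 by auto

lemma X_borel_measurable: "t \<ge> 1 \<Longrightarrow> X t \<in> borel_measurable P"
  using measurable_compose[OF tuple_measurable borel_measurable_continuous_onI[OF continuous_on_fst[OF continuous_on_id]]]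
  by simp

lemma measurable_context_algebraI:
  assumes "t \<ge> 1" "X t \<in> borel_measurable N" "space N = space P"
  shows "X t \<in> measurable N context_algebra"
  unfolding context_algebra_def using assms X_in_space by (intro measurable_restrict_space2) auto

lemma X_measurable: "t \<ge> 1 \<Longrightarrow> X t \<in> measurable P context_algebra"
  by (intro measurable_context_algebraI X_borel_measurable) auto

lemma distr_X: "t \<ge> 1 \<Longrightarrow> distr P context_algebra (X t) = context_law"
proof -
  assume t: "t \<ge> 1"
  have fst: "(fst :: (real^'d) \<times> (real^'k) \<Rightarrow> _) \<in> borel_measurable borel"
    by (intro borel_measurable_continuous_onI continuous_intros)
  have "distr P borel (X s) = distr (distr P borel (\<lambda>\<omega>. (X s \<omega>, Ypot s \<omega>))) borel fst" if "s \<ge> 1" for s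
    using distr_distr[OF fst tuple_measurable[OF that]] by (simp add: comp_def)
  then have eq: "distr P borel (X t) = distr P borel (X 1)"
    using t tuples_ident[OF t] by simp
  show ?thesis unfolding context_law_def
  proof (rule measure_eqI)
    \<comment> \<open>Measurable sets here are traces of Borel sets, and their preimages under
      \<open>X s\<close> agree with those of the Borel sets, so equality of the Borel laws carries
      over.\<close>
    fix B assume "B \<in> sets (distr P context_algebra (X t))"
    then obtain B' where B: "B' \<in> sets borel" "B = S \<inter> B'"
      by (auto simp: context_algebra_def sets_restrict_space)
    have "emeasure (distr P context_algebra (X s)) B = emeasure (distr P borel (X s)) B'" if "s \<ge> 1" for s
    proof -
      have "B \<in> sets context_algebra" using B by (auto simp: context_algebra_def sets_restrict_space)
      moreover have "X s -` B \<inter> space P = X s -` B' \<inter> space P"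
        using B X_in_space[OF that] by auto
      ultimately show ?thesis
        using B X_measurable[OF that] X_borel_measurable[OF that] by (simp add: emeasure_distr)
    qed
    then show "emeasure (distr P context_algebra (X t)) B = emeasure (distr P context_algebra (X 1)) B"
      using t eq by simp
  qed simp
qed

sublocale law: prob_space context_law
  unfolding context_law_def by (intro prob_space_distr X_measurable) simp

lemma space_context: "space context_algebra = S" "space context_law = S"
  by (simp_all add: context_algebra_def context_law_def space_restrict_space)

lemma sets_law: "sets context_law = sets context_algebra"
  by (simp add: context_law_def)

lemma measurable_law: "measurable context_law N = measurable context_algebra N"
  by (rule measurable_cong_sets) (simp_all add: sets_law)

lemma AE_law: "AE x in context_law. x \<in> S \<and> norm x \<le> M"
proof -
  have "norm \<in> borel_measurable context_algebra"
    by (intro measurable_contextD borel_measurable_norm measurable_ident)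
  then have "{x \<in> space context_algebra. norm x \<le> M} \<in> sets context_algebra"
    by measurable
  then have "AE x in context_law. norm x \<le> M"
    unfolding context_law_def using X_bounded[of 1] X_measurable[of 1] by (subst AE_distr_iff) auto
  then show ?thesis
    using AE_space by eventually_elim (simp add: space_context)
qed

lemma AE_X: "t \<ge> 1 \<Longrightarrow> AE \<omega> in P. X t \<omega> \<in> S \<and> norm (X t \<omega>) \<le> M"
  by (rule AE_mp[OF X_bounded AE_I2]) (auto simp: X_in_space)

lemma y_measurable: "(\<lambda>x. y x a) \<in> borel_measurable context_algebra"
  using reward by (simp add: reward_model_def context_algebra_def)

lemma policy_measurable:
  "(\<lambda>z. policy (fst z) (snd z) $ a) \<in> borel_measurable (context_algebra \<Otimes>\<^sub>M borel)"
proof -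
  have "(\<lambda>z. policy (fst z) (snd z) $ a) \<in> borel_measurable (borel \<Otimes>\<^sub>M borel)"
    unfolding borel_prod
    by (rule borel_measurable_vec_nth[OF borel_measurable_continuous_onI])
       (rule continuous_on_clipped_boltzmann[OF \<pi>min pos(5)])
  moreover have "(\<lambda>z. (fst z, snd z)) \<in> measurable (context_algebra \<Otimes>\<^sub>M borel) (borel \<Otimes>\<^sub>M borel)"
    by (intro measurable_Pair measurable_compose[OF measurable_fst] measurable_contextD measurable_snd) simp
  ultimately show ?thesis
    using measurable_compose[of "\<lambda>z. (fst z, snd z)" "context_algebra \<Otimes>\<^sub>M borel" "borel \<Otimes>\<^sub>M borel"] by simp
qed

lemma policy_measurable':
  assumes "f \<in> measurable N context_algebra" "g \<in> borel_measurable N"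
  shows "(\<lambda>\<omega>. policy (f \<omega>) (g \<omega>) $ a) \<in> borel_measurable N"
  using measurable_compose[OF measurable_Pair[OF assms] policy_measurable] by simp

lemma policy_bounds: "\<pi>min \<le> policy x \<beta> $ a" "0 \<le> policy x \<beta> $ a" "policy x \<beta> $ a \<le> 1"
  using clip_ge[of \<pi>min "boltzmann \<gamma> x \<beta>" a] clip_le_1[OF \<pi>min] \<pi>min(1)
  by (simp_all add: clipped_boltzmann_def)

lemma space_past: "space (past t) = space P"
  by (simp add: past_def)

lemma history_measurable: "t \<ge> 1 \<Longrightarrow> history X p A Y t \<in> measurable P (history_space t)"
  using tuple_indep_history by (auto simp: indep_rv_def)

lemma history_measurable_past: "history X p A Y t \<in> measurable (past t) (history_space t)"
  unfolding past_def
  by (rule measurable_vimage_algebra1)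
     (auto simp: history_space_def history_def space_PiM space_pair_measure)

text \<open>Transfers measurability from \<open>past t\<close> to any sigma-algebra that makes the
  history measurable: to \<open>P\<close>, to \<open>decision_algebra\<close>, and to the one
  generated by history, context and action.\<close>

lemma past_measurable_trans:
  assumes "history X p A Y t \<in> measurable N (history_space t)" "space N = space P"
    and "V \<in> measurable (past t) N'"
  shows "V \<in> measurable N N'"
proof -
  have "(\<lambda>\<omega>. \<omega>) \<in> measurable N (past t)"
    unfolding past_def using assms by (intro measurable_vimage_algebra2) auto
  from measurable_compose[OF this assms(3)] show ?thesis .
qed

lemma past_measurable: "t \<ge> 1 \<Longrightarrow> V \<in> measurable (past t) N' \<Longrightarrow> V \<in> measurable P N'"
  by (rule past_measurable_trans[OF history_measurable]) auto

lemma round_measurable_past: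
  assumes "\<tau> \<in> {1..<t}"
  shows "X \<tau> \<in> borel_measurable (past t)" "A \<tau> \<in> measurable (past t) (count_space UNIV)"
    "Y \<tau> \<in> borel_measurable (past t)"
proof -
  have eq: "history X p A Y t \<omega> \<tau> = (X \<tau> \<omega>, p \<tau> \<omega>, A \<tau> \<omega>, Y \<tau> \<omega>)" for \<omega>
    using assms by (simp add: history_def)
  have "(\<lambda>\<omega>. history X p A Y t \<omega> \<tau>) \<in> measurable (past t) (borel \<Otimes>\<^sub>M (borel \<Otimes>\<^sub>M (count_space UNIV \<Otimes>\<^sub>M borel)))"
    by (rule measurable_compose[OF history_measurable_past])
       (unfold history_space_def, rule measurable_component_singleton[OF assms])
  then have m: "(\<lambda>\<omega>. (X \<tau> \<omega>, p \<tau> \<omega>, A \<tau> \<omega>, Y \<tau> \<omega>)) \<in> measurable (past t) (borel \<Otimes>\<^sub>M (borel \<Otimes>\<^sub>M (count_space UNIV \<Otimes>\<^sub>M borel)))"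
    unfolding eq .
  note m' = measurable_compose[OF m measurable_snd, simplified]
  note m'' = measurable_compose[OF m' measurable_snd, simplified]
  show "X \<tau> \<in> borel_measurable (past t)" using measurable_compose[OF m measurable_fst] by simp
  show "A \<tau> \<in> measurable (past t) (count_space UNIV)" using measurable_compose[OF m'' measurable_fst] by simp
  show "Y \<tau> \<in> borel_measurable (past t)" using measurable_compose[OF m'' measurable_snd] by simp
qed

lemma chosen_measurable:
  assumes "f \<in> measurable N (count_space UNIV)"
  shows "(\<lambda>\<omega>. of_bool (f \<omega> = a) :: real) \<in> borel_measurable N"
  using measurable_compose[OF assms, of "\<lambda>b. of_bool (b = a)" borel] by simp

lemma gram_coercive:
  "lam * (norm v)\<^sup>2 \<le> v \<bullet> ((mat lam + (\<Sum>\<tau>\<in>I. of_bool (A \<tau> \<omega> = a) *\<^sub>R outer (X \<tau> \<omega>) (X \<tau> \<omega>))) *v v)"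
proof -
  have "(\<Sum>\<tau>\<in>I. of_bool (A \<tau> \<omega> = a) *\<^sub>R outer (X \<tau> \<omega>) (X \<tau> \<omega>)) *v v
      = (\<Sum>\<tau>\<in>I. of_bool (A \<tau> \<omega> = a) *\<^sub>R ((X \<tau> \<omega> \<bullet> v) *\<^sub>R X \<tau> \<omega>))"
    by (induction I rule: infinite_finite_induct)
       (simp_all add: matrix_vector_mult_add_rdistrib scaleR_matrix_vector_assoc[symmetric] outer_mult_vec)
  then show ?thesis
    by (simp add: mat_mult_vec matrix_vector_mult_add_rdistrib inner_add_right inner_sum_right power2_norm_eq_inner)
       (simp add: sum_nonneg inner_commute)
qed

lemma gram_invertible:
  "invertible (mat lam + (\<Sum>\<tau>\<in>I. of_bool (A \<tau> \<omega> = a) *\<^sub>R outer (X \<tau> \<omega>) (X \<tau> \<omega>)))"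
  by (rule coercive_invertible[OF pos(6) gram_coercive])

lemma outer_measurable:
  assumes "f \<in> borel_measurable N"
  shows "(\<lambda>\<omega>. outer (f \<omega>) (f \<omega>)) \<in> borel_measurable N"
  by (intro borel_measurable_vecI)
     (simp add: outer_def borel_measurable_times[OF borel_measurable_vec_nth[OF assms] borel_measurable_vec_nth[OF assms]])

text \<open>The estimate of round \<open>s\<close> uses the rounds before \<open>s\<close>, so
  \<open>s = t\<close> is allowed: the sequence of estimates is predictable.\<close>

lemma \<beta>hat_measurable_past:
  assumes "s \<le> t"
  shows "\<beta>hat s \<in> borel_measurable (past t)"
proof (rule borel_measurable_vecI)
  fix a
  have "(\<lambda>\<omega>. matrix_inv (mat lam + (\<Sum>\<tau>\<in>{1..<s}. of_bool (A \<tau> \<omega> = a) *\<^sub>R outer (X \<tau> \<omega>) (X \<tau> \<omega>)))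
      *v (\<Sum>\<tau>\<in>{1..<s}. of_bool (A \<tau> \<omega> = a) *\<^sub>R (Y \<tau> \<omega> *\<^sub>R X \<tau> \<omega>))) \<in> borel_measurable (past t)"
    using assms
    by (intro borel_measurable_matrix_inv_mult gram_invertible borel_measurable_add borel_measurable_const
        borel_measurable_sum borel_measurable_scaleR chosen_measurable outer_measurable round_measurable_past) auto
  then show "(\<lambda>\<omega>. \<beta>hat s \<omega> $ a) \<in> borel_measurable (past t)"
    by (simp add: ridge_def)
qed

lemma \<beta>hat_measurable: "t \<ge> 1 \<Longrightarrow> \<beta>hat t \<in> borel_measurable P"
  by (rule past_measurable[OF _ \<beta>hat_measurable_past[OF order_refl]])

lemma drift_measurable:
  assumes "\<phi> \<in> borel_measurable context_algebra"
  shows "drift a \<phi> \<in> borel_measurable borel"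
  unfolding drift_def[abs_def]
proof (rule law.borel_measurable_lebesgue_integral)
  have "(\<lambda>z. (policy (snd z) (fst z) $ a) *\<^sub>R \<phi> (snd z)) \<in> borel_measurable (borel \<Otimes>\<^sub>M context_algebra)"
    by (intro borel_measurable_scaleR policy_measurable' measurable_snd measurable_fst
        measurable_compose[OF measurable_snd assms])
  then show "(\<lambda>(\<beta>, x). (policy x \<beta> $ a) *\<^sub>R \<phi> x) \<in> borel_measurable (borel \<Otimes>\<^sub>M context_law)"
    unfolding case_prod_beta' measurable_cong_sets[OF sets_pair_measure_cong[OF refl sets_law] refl] .
qed

subsection \<open>Martingale differences\<close>

text \<open>Averages over the fresh context with everything from the past frozen. The context
  inherits its independence from the full tuple of context and outcomes.\<close>

lemma context_independent_integral:
  fixes f :: "_ \<Rightarrow> 'b::{banach, second_countable_topology}"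
  assumes t: "t \<ge> 1" and V: "V \<in> measurable (past t) N"
    and f: "f \<in> borel_measurable (context_algebra \<Otimes>\<^sub>M N)"
    and int: "integrable P (\<lambda>\<omega>. f (X t \<omega>, V \<omega>))"
  shows "(\<integral>\<omega>. f (X t \<omega>, V \<omega>) \<partial>P) = (\<integral>\<omega>. (\<integral>x. f (x, V \<omega>) \<partial>context_law) \<partial>P)"
proof -
  let ?G = "vimage_algebra (space P) (\<lambda>\<omega>. (X t \<omega>, Ypot t \<omega>)) borel"
  have indep: "indep_set (sets ?G) (sets (past t))"
    using tuple_indep_history[OF t] by (simp add: indep_rv_def past_def)
  have "(\<lambda>\<omega>. (X t \<omega>, Ypot t \<omega>)) \<in> measurable ?G borel"
    by (rule measurable_vimage_algebra1) simp
  from measurable_compose[OF this borel_measurable_continuous_onI[OF continuous_on_fst[OF continuous_on_id]]]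
  have "X t \<in> measurable ?G context_algebra"
    using t by (intro measurable_context_algebraI) simp_all
  from integral_indep_set[OF indep this V _ space_past f int] show ?thesis
    by (simp add: distr_X[OF t])
qed

text \<open>The tower property: \<open>f\<close> is known when the action is drawn, so the indicator
  of the action may be replaced by its conditional probability, which is the clipped policy.\<close>

lemma action_integral:
  assumes t: "t \<ge> 1" and f: "f \<in> borel_measurable (decision_algebra P X p A Y t)"
    and int: "integrable P f"
  shows "(\<integral>\<omega>. of_bool (A t \<omega> = a) * f \<omega> \<partial>P) = (\<integral>\<omega>. policy (X t \<omega>) (\<beta>hat t \<omega>) $ a * f \<omega> \<partial>P)"
proof -
  let ?G = "decision_algebra P X p A Y t" and ?E = "{\<omega> \<in> space P. A t \<omega> = a}"
  have pair: "(\<lambda>\<omega>. (history X p A Y t \<omega>, X t \<omega>)) \<in> measurable P (history_space t \<Otimes>\<^sub>M borel)"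
    by (intro measurable_Pair history_measurable X_borel_measurable t)
  have "sets ?G \<subseteq> events"
    unfolding decision_algebra_def by (rule sets_image_in_sets[OF refl pair])
  then have sub: "subalgebra P ?G"
    by (simp add: subalgebra_def decision_algebra_def)
  then have "finite_measure_subalgebra P ?G"
    by (simp add: finite_measure_subalgebra_def finite_measure_axioms finite_measure_subalgebra_axioms_def)
  then interpret G: sigma_finite_subalgebra P ?G
    by (rule finite_measure_subalgebra_is_sigma_finite)
  have E: "?E \<in> events"
    using measurable_sets[OF A_measurable[OF t], of "{a}"] by (simp add: vimage_def Int_def conj_commute)
  have fP: "f \<in> borel_measurable P" by (rule measurable_from_subalg[OF sub f])
  have intE: "integrable P (\<lambda>\<omega>. f \<omega> * indicator ?E \<omega>)"
    using integrable_mult_indicator[OF E int] by (simp add: mult.commute)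
  have "(\<integral>\<omega>. of_bool (A t \<omega> = a) * f \<omega> \<partial>P) = (\<integral>\<omega>. f \<omega> * indicator ?E \<omega> \<partial>P)"
    by (intro Bochner_Integration.integral_cong) (auto simp: indicator_def)
  also have "\<dots> = (\<integral>\<omega>. f \<omega> * real_cond_exp P ?G (indicator ?E) \<omega> \<partial>P)"
    by (rule G.real_cond_exp_intg(2)[OF intE f, symmetric]) (use E in simp)
  also have "\<dots> = (\<integral>\<omega>. p t \<omega> $ a * f \<omega> \<partial>P)"
  proof (rule integral_cong_AE)
    show "(\<lambda>\<omega>. f \<omega> * real_cond_exp P ?G (indicator ?E) \<omega>) \<in> borel_measurable P"
      by (intro borel_measurable_times fP borel_measurable_cond_exp2)
    show "(\<lambda>\<omega>. p t \<omega> $ a * f \<omega>) \<in> borel_measurable P"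
      by (rule borel_measurable_times[OF borel_measurable_vec_nth[OF p_measurable[OF t]] fP])
    show "AE \<omega> in P. f \<omega> * real_cond_exp P ?G (indicator ?E) \<omega> = p t \<omega> $ a * f \<omega>"
      using action_drawn[OF t, of a] by (auto simp: cond_prob_given_def)
  qed
  also have "\<dots> = (\<integral>\<omega>. policy (X t \<omega>) (\<beta>hat t \<omega>) $ a * f \<omega> \<partial>P)"
    using behavior[OF t] by (intro Bochner_Integration.integral_cong) auto
  finally show ?thesis .
qed

lemma past_measurable_decision:
  assumes "t \<ge> 1" "V \<in> measurable (past t) N"
  shows "V \<in> measurable (decision_algebra P X p A Y t) N"
    and "X t \<in> measurable (decision_algebra P X p A Y t) context_algebra"
proof -
  let ?G = "decision_algebra P X p A Y t"
  have G: "(\<lambda>\<omega>. (history X p A Y t \<omega>, X t \<omega>)) \<in> measurable ?G (history_space t \<Otimes>\<^sub>M borel)"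
    unfolding decision_algebra_def using measurable_space[OF history_measurable[OF assms(1)]]
    by (intro measurable_vimage_algebra1) (auto simp: space_pair_measure)
  have "space ?G = space P" by (simp add: decision_algebra_def)
  then show "V \<in> measurable ?G N" "X t \<in> measurable ?G context_algebra"
    using measurable_compose[OF G measurable_fst] measurable_compose[OF G measurable_snd] assms
    by (auto intro!: past_measurable_trans[of t ?G] measurable_context_algebraI)
qed

section \<open>Size of drifts and their dependence on the parameter\<close>

lemma policy_integrable:
  assumes \<phi>: "\<phi> \<in> borel_measurable context_algebra"
    and bound: "\<And>x. x \<in> S \<Longrightarrow> norm x \<le> M \<Longrightarrow> norm (\<phi> x) \<le> C"
  shows "integrable context_law (\<lambda>x. (policy x \<beta> $ a) *\<^sub>R (\<phi> x :: 'b::euclidean_space))"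
proof (rule law.integrable_const_bound)
  show "AE x in context_law. norm ((policy x \<beta> $ a) *\<^sub>R \<phi> x) \<le> C"
    using AE_law
  proof eventually_elim
    case (elim x)
    then have "norm (\<phi> x) \<le> C" by (intro bound) auto
    then show ?case
      using mult_mono[OF policy_bounds(3) \<open>norm (\<phi> x) \<le> C\<close>] policy_bounds(2) by auto
  qed
  show "(\<lambda>x. (policy x \<beta> $ a) *\<^sub>R \<phi> x) \<in> borel_measurable context_law"
    unfolding measurable_law
    by (intro borel_measurable_scaleR policy_measurable' \<phi> measurable_ident_sets[OF refl] borel_measurable_const)
qed

lemma drift_norm_le:
  assumes \<phi>: "\<phi> \<in> borel_measurable context_algebra"
    and bound: "\<And>x. x \<in> S \<Longrightarrow> norm x \<le> M \<Longrightarrow> norm (\<phi> x) \<le> C"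
  shows "norm (drift a \<phi> \<beta>) \<le> C"
proof -
  have "norm (drift a \<phi> \<beta>) \<le> (\<integral>x. norm ((policy x \<beta> $ a) *\<^sub>R \<phi> x) \<partial>context_law)"
    unfolding drift_def by (rule integral_norm_bound)
  also have "\<dots> \<le> (\<integral>x. C \<partial>context_law)"
  proof (rule integral_mono_AE)
    show "AE x in context_law. norm ((policy x \<beta> $ a) *\<^sub>R \<phi> x) \<le> C"
      using AE_law
    proof eventually_elim
      case (elim x)
      then have "norm (\<phi> x) \<le> C" by (intro bound) auto
      then show ?case
        using mult_mono[OF policy_bounds(3) \<open>norm (\<phi> x) \<le> C\<close>] policy_bounds(2) by auto
    qed
    show "integrable context_law (\<lambda>x. norm ((policy x \<beta> $ a) *\<^sub>R \<phi> x))"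
      by (rule integrable_norm[OF policy_integrable[OF \<phi> bound]])
  qed simp
  finally show ?thesis by (simp add: law.prob_space)
qed

lemma drift_diff_le:
  assumes \<phi>: "\<phi> \<in> borel_measurable context_algebra"
    and bound: "\<And>x. x \<in> S \<Longrightarrow> norm x \<le> M \<Longrightarrow> norm (\<phi> x) \<le> C"
    and e: "\<And>x. x \<in> S \<Longrightarrow> norm x \<le> M \<Longrightarrow> \<bar>policy x \<beta> $ a - policy x \<beta>' $ a\<bar> \<le> e"
  shows "norm (drift a \<phi> \<beta> - drift a \<phi> \<beta>') \<le> e * C"
proof -
  note int = policy_integrable[OF \<phi> bound]
  have "drift a \<phi> \<beta> - drift a \<phi> \<beta>' = (\<integral>x. (policy x \<beta> $ a) *\<^sub>R \<phi> x - (policy x \<beta>' $ a) *\<^sub>R \<phi> x \<partial>context_law)"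
    unfolding drift_def using int by (intro Bochner_Integration.integral_diff[symmetric]) auto
  also have "norm \<dots> \<le> (\<integral>x. norm ((policy x \<beta> $ a) *\<^sub>R \<phi> x - (policy x \<beta>' $ a) *\<^sub>R \<phi> x) \<partial>context_law)"
    by (rule integral_norm_bound)
  also have "\<dots> \<le> (\<integral>x. e * C \<partial>context_law)"
  proof (rule integral_mono_AE)
    show "AE x in context_law. norm ((policy x \<beta> $ a) *\<^sub>R \<phi> x - (policy x \<beta>' $ a) *\<^sub>R \<phi> x) \<le> e * C"
      using AE_law
    proof eventually_elim
      case (elim x)
      then have "norm (\<phi> x) \<le> C" "\<bar>policy x \<beta> $ a - policy x \<beta>' $ a\<bar> \<le> e"
        using bound e by auto
      then have "\<bar>policy x \<beta> $ a - policy x \<beta>' $ a\<bar> * norm (\<phi> x) \<le> e * C"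
        by (intro mult_mono) (auto intro: order_trans[OF abs_ge_zero])
      then show ?case by (simp flip: scaleR_left_diff_distrib)
    qed
  qed (use int in auto)
  finally show ?thesis by (simp add: law.prob_space)
qed

text \<open>A martingale difference: the drift at the current estimate is the conditional mean of
  the first term given \<open>past t\<close>, as tested in
  \<open>centered_orthogonal_past\<close>.\<close>

definition centered :: "'k \<Rightarrow> (real^'d \<Rightarrow> 'b::euclidean_space) \<Rightarrow> nat \<Rightarrow> 'w \<Rightarrow> 'b" where
  "centered a \<phi> t \<omega> = of_bool (A t \<omega> = a) *\<^sub>R \<phi> (X t \<omega>) - drift a \<phi> (\<beta>hat t \<omega>)"

context
  fixes \<phi> :: "real^'d \<Rightarrow> 'b::euclidean_space" and C :: real
  assumes \<phi>: "\<phi> \<in> borel_measurable context_algebra"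
    and bound: "\<And>x. x \<in> S \<Longrightarrow> norm x \<le> M \<Longrightarrow> norm (\<phi> x) \<le> C"
begin

lemma AE_\<phi>: "t \<ge> 1 \<Longrightarrow> AE \<omega> in P. norm (\<phi> (X t \<omega>)) \<le> C"
  using AE_X[of t] by (auto intro: bound)

lemma centered_measurable_past: "s \<in> {1..<t} \<Longrightarrow> centered a \<phi> s \<in> borel_measurable (past t)"
  unfolding centered_def[abs_def]
proof (intro borel_measurable_diff borel_measurable_scaleR chosen_measurable round_measurable_past)
  assume s: "s \<in> {1..<t}"
  then have X: "X s \<in> measurable (past t) context_algebra"
    by (intro measurable_context_algebraI round_measurable_past space_past) auto
  then show "(\<lambda>\<omega>. \<phi> (X s \<omega>)) \<in> borel_measurable (past t)"
    by (rule measurable_compose[OF _ \<phi>])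
  have "\<beta>hat s \<in> borel_measurable (past t)"
    using s by (intro \<beta>hat_measurable_past) auto
  then show "(\<lambda>\<omega>. drift a \<phi> (\<beta>hat s \<omega>)) \<in> borel_measurable (past t)"
    by (rule measurable_compose[OF _ drift_measurable[OF \<phi>]])
qed

lemma centered_measurable: "t \<ge> 1 \<Longrightarrow> centered a \<phi> t \<in> borel_measurable P"
  by (rule past_measurable[of "Suc t"]) (auto intro: centered_measurable_past)

lemma AE_centered: "t \<ge> 1 \<Longrightarrow> AE \<omega> in P. norm (centered a \<phi> t \<omega>) \<le> 2 * C"
proof (rule AE_mp[OF AE_\<phi> AE_I2], safe)
  fix \<omega> assume elim: "norm (\<phi> (X t \<omega>)) \<le> C"
  have "norm (of_bool (A t \<omega> = a) *\<^sub>R \<phi> (X t \<omega>)) \<le> C"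
    using elim by (auto intro: order_trans[OF norm_ge_zero])
  then show "norm (centered a \<phi> t \<omega>) \<le> 2 * C"
    unfolding centered_def
    using norm_triangle_ineq4[of "of_bool (A t \<omega> = a) *\<^sub>R \<phi> (X t \<omega>)" "drift a \<phi> (\<beta>hat t \<omega>)"]
      drift_norm_le[OF \<phi> bound, of a "\<beta>hat t \<omega>"] by linarith
qed

text \<open>States conditional mean zero by testing against bounded past-measurable
  \<open>g\<close>. The mean is computed in two stages, first over the action given past and
  context, then over the context given the past.\<close>

lemma centered_orthogonal_past:
  assumes t: "t \<ge> 1" and g: "g \<in> borel_measurable (past t)"
    and g_bound: "AE \<omega> in P. norm (g \<omega>) \<le> D"
  shows "(\<integral>\<omega>. centered a \<phi> t \<omega> \<bullet> g \<omega> \<partial>P) = 0"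
proof -
  have gP: "g \<in> borel_measurable P" by (rule past_measurable[OF t g])
  have \<phi>X: "(\<lambda>\<omega>. \<phi> (X t \<omega>)) \<in> borel_measurable P"
    by (rule measurable_compose[OF X_measurable[OF t] \<phi>])
  have pol: "(\<lambda>\<omega>. policy (X t \<omega>) (\<beta>hat t \<omega>) $ a) \<in> borel_measurable P"
    by (intro policy_measurable' X_measurable \<beta>hat_measurable t)
  have prod_bound: "AE \<omega> in P. \<bar>\<phi> (X t \<omega>) \<bullet> g \<omega>\<bar> \<le> C * D"
    using AE_\<phi>[OF t] g_bound
  proof eventually_elim
    case (elim \<omega>)
    have "\<bar>\<phi> (X t \<omega>) \<bullet> g \<omega>\<bar> \<le> norm (\<phi> (X t \<omega>)) * norm (g \<omega>)" by (rule Cauchy_Schwarz_ineq2)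
    also have "\<dots> \<le> C * D" using elim by (intro mult_mono) (auto intro: order_trans[OF norm_ge_zero])
    finally show ?case .
  qed
  have int: "integrable P (\<lambda>\<omega>. \<phi> (X t \<omega>) \<bullet> g \<omega>)"
    using prod_bound by (intro integrable_const_bound[where B="C * D"] borel_measurable_inner \<phi>X gP) simp
  have "AE \<omega> in P. \<bar>policy (X t \<omega>) (\<beta>hat t \<omega>) $ a * (\<phi> (X t \<omega>) \<bullet> g \<omega>)\<bar> \<le> C * D"
    using prod_bound
  proof eventually_elim
    case (elim \<omega>)
    then show ?case
      using mult_mono[OF policy_bounds(3) elim, of "X t \<omega>" "\<beta>hat t \<omega>" a] policy_bounds(2) by (simp add: abs_mult)
  qed
  then have int_pol: "integrable P (\<lambda>\<omega>. policy (X t \<omega>) (\<beta>hat t \<omega>) $ a * (\<phi> (X t \<omega>) \<bullet> g \<omega>))"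
    by (intro integrable_const_bound[where B="C * D"] borel_measurable_times borel_measurable_inner \<phi>X gP pol) simp
  have int_drift: "integrable P (\<lambda>\<omega>. drift a \<phi> (\<beta>hat t \<omega>) \<bullet> g \<omega>)"
  proof (rule integrable_const_bound[where B="C * D"])
    show "AE \<omega> in P. norm (drift a \<phi> (\<beta>hat t \<omega>) \<bullet> g \<omega>) \<le> C * D"
      using g_bound
    proof eventually_elim
      case (elim \<omega>)
      have "\<bar>drift a \<phi> (\<beta>hat t \<omega>) \<bullet> g \<omega>\<bar> \<le> norm (drift a \<phi> (\<beta>hat t \<omega>)) * norm (g \<omega>)"
        by (rule Cauchy_Schwarz_ineq2)
      also have "\<dots> \<le> C * D"
        using elim drift_norm_le[OF \<phi> bound, of a "\<beta>hat t \<omega>"]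
        by (intro mult_mono) (auto intro: order_trans[OF norm_ge_zero])
      finally show ?case by simp
    qed
    show "(\<lambda>\<omega>. drift a \<phi> (\<beta>hat t \<omega>) \<bullet> g \<omega>) \<in> borel_measurable P"
      by (intro borel_measurable_inner gP measurable_compose[OF \<beta>hat_measurable[OF t] drift_measurable[OF \<phi>]])
  qed
  have int_A: "integrable P (\<lambda>\<omega>. of_bool (A t \<omega> = a) * (\<phi> (X t \<omega>) \<bullet> g \<omega>))"
  proof (rule Bochner_Integration.integrable_bound[OF int])
    show "(\<lambda>\<omega>. of_bool (A t \<omega> = a) * (\<phi> (X t \<omega>) \<bullet> g \<omega>)) \<in> borel_measurable P"
      by (intro borel_measurable_times borel_measurable_inner \<phi>X gP chosen_measurable A_measurable t)
  qed simp
  have "(\<lambda>\<omega>. \<phi> (X t \<omega>) \<bullet> g \<omega>) \<in> borel_measurable (decision_algebra P X p A Y t)"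
    by (intro borel_measurable_inner measurable_compose[OF past_measurable_decision(2)[OF t g] \<phi>]
        past_measurable_decision(1)[OF t g])
  from action_integral[OF t this int]
  have "(\<integral>\<omega>. of_bool (A t \<omega> = a) * (\<phi> (X t \<omega>) \<bullet> g \<omega>) \<partial>P)
      = (\<integral>\<omega>. policy (X t \<omega>) (\<beta>hat t \<omega>) $ a * (\<phi> (X t \<omega>) \<bullet> g \<omega>) \<partial>P)" .
  also have "\<dots> = (\<integral>\<omega>. (\<integral>x. policy x (\<beta>hat t \<omega>) $ a * (\<phi> x \<bullet> g \<omega>) \<partial>context_law) \<partial>P)"
  proof -
    \<comment> \<open>The estimate and the value of \<open>g\<close> are frozen together, as one
      pair measurable in the past.\<close>
    let ?f = "\<lambda>(x, \<beta>, v). policy x \<beta> $ a * (\<phi> x \<bullet> v)"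
    have "?f \<in> borel_measurable (context_algebra \<Otimes>\<^sub>M (borel \<Otimes>\<^sub>M borel))"
      unfolding case_prod_beta'
      by (intro borel_measurable_times borel_measurable_inner policy_measurable' measurable_fst
          measurable_compose[OF measurable_fst \<phi>] measurable_compose[OF measurable_snd measurable_fst]
          measurable_compose[OF measurable_snd measurable_snd])
    from context_independent_integral[OF t measurable_Pair[OF \<beta>hat_measurable_past[OF order_refl] g] this] int_pol
    show ?thesis by simp
  qed
  also have "\<dots> = (\<integral>\<omega>. drift a \<phi> (\<beta>hat t \<omega>) \<bullet> g \<omega> \<partial>P)"
  proof (intro Bochner_Integration.integral_cong refl)
    fix \<omega>
    have "(\<integral>x. ((policy x (\<beta>hat t \<omega>) $ a) *\<^sub>R \<phi> x) \<bullet> g \<omega> \<partial>context_law) = drift a \<phi> (\<beta>hat t \<omega>) \<bullet> g \<omega>"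
      unfolding drift_def using policy_integrable[OF \<phi> bound] by (intro integral_inner_left) auto
    then show "(\<integral>x. policy x (\<beta>hat t \<omega>) $ a * (\<phi> x \<bullet> g \<omega>) \<partial>context_law) = drift a \<phi> (\<beta>hat t \<omega>) \<bullet> g \<omega>"
      by simp
  qed
  finally show ?thesis
    using int_A int_drift by (simp add: centered_def inner_diff_left)
qed

lemma centered_sum_bound:
  "integrable P (\<lambda>\<omega>. norm (\<Sum>\<tau>\<in>{1..<t}. centered a \<phi> \<tau> \<omega>))"
  "(\<integral>\<omega>. norm (\<Sum>\<tau>\<in>{1..<t}. centered a \<phi> \<tau> \<omega>) \<partial>P) \<le> 2 * C * sqrt (real (t - 1))"
proof -
  \<comment> \<open>\<open>C\<close> dominates the norm of some drift and is therefore
    nonnegative.\<close>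
  have C: "0 \<le> C"
    using drift_norm_le[OF \<phi> bound, of a 0] norm_ge_zero order_trans by blast
  have sq_bound: "AE \<omega> in P. (norm (centered a \<phi> \<tau> \<omega>))\<^sup>2 \<le> (2 * C)\<^sup>2" if "\<tau> \<in> {1..<t}" for \<tau>
  proof -
    have "1 \<le> \<tau>" using that by simp
    from AE_centered[OF this, of a] show ?thesis
      by eventually_elim (rule power_mono, simp_all)
  qed
  have sq: "integrable P (\<lambda>\<omega>. (norm (centered a \<phi> \<tau> \<omega>))\<^sup>2)" if "\<tau> \<in> {1..<t}" for \<tau>
    using that sq_bound[OF that] centered_measurable[of \<tau> a]
    by (intro integrable_const_bound[where B="(2 * C)\<^sup>2"]) auto
  have le: "(\<integral>\<omega>. (norm (centered a \<phi> \<tau> \<omega>))\<^sup>2 \<partial>P) \<le> (2 * C)\<^sup>2" if "\<tau> \<in> {1..<t}" for \<tau>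
    using integral_mono_AE[OF sq[OF that] _ sq_bound[OF that]] by (simp add: prob_space)
  have orth: "(\<integral>\<omega>. centered a \<phi> i \<omega> \<bullet> centered a \<phi> j \<omega> \<partial>P) = 0"
    if "i \<in> {1..<t}" "j \<in> {1..<t}" "i < j" for i j
    using centered_orthogonal_past[of j "centered a \<phi> i" "2 * C" a] centered_measurable_past[of i j a] AE_centered[of i a] that
    by (simp add: inner_commute)
  have meas: "centered a \<phi> \<tau> \<in> borel_measurable P" if "\<tau> \<in> {1..<t}" for \<tau>
    using that by (intro centered_measurable) simp
  show "integrable P (\<lambda>\<omega>. norm (\<Sum>\<tau>\<in>{1..<t}. centered a \<phi> \<tau> \<omega>))"
    by (rule orthogonal_sum_bound(1)[OF finite_atLeastLessThan meas sq le orth])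
  have "(\<integral>\<omega>. norm (\<Sum>\<tau>\<in>{1..<t}. centered a \<phi> \<tau> \<omega>) \<partial>P) \<le> sqrt (real (card {1..<t}) * (2 * C)\<^sup>2)"
    by (rule orthogonal_sum_bound(2)[OF finite_atLeastLessThan meas sq le orth])
  then show "(\<integral>\<omega>. norm (\<Sum>\<tau>\<in>{1..<t}. centered a \<phi> \<tau> \<omega>) \<partial>P) \<le> 2 * C * sqrt (real (t - 1))"
    using C by (simp add: real_sqrt_mult mult.commute)
qed

end

subsection \<open>The noise\<close>

definition noise_term :: "'k \<Rightarrow> nat \<Rightarrow> 'w \<Rightarrow> real^'d" where
  "noise_term a t \<omega> = (of_bool (A t \<omega> = a) * \<eta> t \<omega>) *\<^sub>R X t \<omega>"

lemma reward_eq: "t \<ge> 1 \<Longrightarrow> AE \<omega> in P. Y t \<omega> = y (X t \<omega>) (A t \<omega>) + \<eta> t \<omega>"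
  and \<eta>_indep: "t \<ge> 1 \<Longrightarrow> indep_rv P borel (\<eta> t)
        (history_space t \<Otimes>\<^sub>M (borel \<Otimes>\<^sub>M count_space UNIV))
        (\<lambda>\<omega>. (history X p A Y t \<omega>, X t \<omega>, A t \<omega>))"
  and \<eta>_mean: "t \<ge> 1 \<Longrightarrow> integrable P (\<eta> t)" "t \<ge> 1 \<Longrightarrow> integral\<^sup>L P (\<eta> t) = 0"
  and \<eta>_square: "t \<ge> 1 \<Longrightarrow> integrable P (\<lambda>\<omega>. (\<eta> t \<omega>)\<^sup>2)"
    "t \<ge> 1 \<Longrightarrow> integral\<^sup>L P (\<lambda>\<omega>. (\<eta> t \<omega>)\<^sup>2) \<le> \<sigma>\<eta>\<^sup>2"
  using reward by (auto simp: reward_model_def)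

lemma noise_measurable: "t \<ge> 1 \<Longrightarrow> noise_term a t \<in> borel_measurable P"
  unfolding noise_term_def[abs_def]
  by (intro borel_measurable_scaleR borel_measurable_times chosen_measurable A_measurable X_borel_measurable
      borel_measurable_integrable \<eta>_mean)

lemma noise_square:
  assumes t: "t \<ge> 1"
  shows "integrable P (\<lambda>\<omega>. (norm (noise_term a t \<omega>))\<^sup>2)"
    "(\<integral>\<omega>. (norm (noise_term a t \<omega>))\<^sup>2 \<partial>P) \<le> (M * \<sigma>\<eta>)\<^sup>2"
proof -
  have le: "AE \<omega> in P. (norm (noise_term a t \<omega>))\<^sup>2 \<le> M\<^sup>2 * (\<eta> t \<omega>)\<^sup>2"
    using X_bounded[OF t]
  proof eventually_elim
    case (elim \<omega>)
    have "norm (noise_term a t \<omega>) \<le> M * \<bar>\<eta> t \<omega>\<bar>"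
      using mult_right_mono[OF elim, of "\<bar>\<eta> t \<omega>\<bar>"] pos by (simp add: noise_term_def abs_mult mult.commute)
    then show ?case using power_mono[of "norm (noise_term a t \<omega>)" "M * \<bar>\<eta> t \<omega>\<bar>" 2] by (simp add: power_mult_distrib)
  qed
  have int: "integrable P (\<lambda>\<omega>. M\<^sup>2 * (\<eta> t \<omega>)\<^sup>2)" using \<eta>_square[OF t] by simp
  show sq: "integrable P (\<lambda>\<omega>. (norm (noise_term a t \<omega>))\<^sup>2)"
    using le noise_measurable[OF t, of a] by (intro Bochner_Integration.integrable_bound[OF int]) auto
  have "(\<integral>\<omega>. (norm (noise_term a t \<omega>))\<^sup>2 \<partial>P) \<le> (\<integral>\<omega>. M\<^sup>2 * (\<eta> t \<omega>)\<^sup>2 \<partial>P)"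
    by (rule integral_mono_AE[OF sq int le])
  also have "\<dots> \<le> M\<^sup>2 * \<sigma>\<eta>\<^sup>2"
    using \<eta>_square(2)[OF t] by (simp add: mult_left_mono)
  finally show "(\<integral>\<omega>. (norm (noise_term a t \<omega>))\<^sup>2 \<partial>P) \<le> (M * \<sigma>\<eta>)\<^sup>2" by (simp add: power_mult_distrib)
qed

text \<open>Given history, context and action of round \<open>j\<close>, the noise of round
  \<open>j\<close> still has mean zero, so it remains to express the term of round \<open>i\<close>
  through the history.\<close>

lemma noise_orthogonal:
  assumes i: "i \<ge> 1" and "i < j"
  shows "(\<integral>\<omega>. noise_term a i \<omega> \<bullet> noise_term a j \<omega> \<partial>P) = 0"
proof -
  have j: "j \<ge> 1" and ij: "i \<in> {1..<j}" using assms by auto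
  let ?F = "vimage_algebra (space P) (\<eta> j) borel"
  let ?G = "vimage_algebra (space P) (\<lambda>\<omega>. (history X p A Y j \<omega>, X j \<omega>, A j \<omega>))
      (history_space j \<Otimes>\<^sub>M (borel \<Otimes>\<^sub>M count_space UNIV))"
  have indep: "indep_set (sets ?F) (sets ?G)"
    using \<eta>_indep[OF j] by (simp add: indep_rv_def)
  have "(\<lambda>\<omega>. (history X p A Y j \<omega>, X j \<omega>, A j \<omega>)) \<in> measurable ?G (history_space j \<Otimes>\<^sub>M (borel \<Otimes>\<^sub>M count_space UNIV))"
    using measurable_space[OF history_measurable[OF j]]
    by (intro measurable_vimage_algebra1) (auto simp: space_pair_measure)
  note G = measurable_compose[OF this measurable_fst, simplified] measurable_compose[OF this measurable_snd, simplified]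
  have past: "V \<in> measurable ?G N" if "V \<in> measurable (past j) N" for V and N :: "'z measure"
    using G(1) by (rule past_measurable_trans) (use that in auto)
  have XA: "X j \<in> borel_measurable ?G" "A j \<in> measurable ?G (count_space UNIV)"
    using measurable_compose[OF G(2) measurable_fst] measurable_compose[OF G(2) measurable_snd] by simp_all
  \<comment> \<open>The history does not record \<open>\<eta> i\<close>, but almost surely on
    \<open>A i = a\<close> it equals \<open>Y i - y (X i) a\<close>, which the history
    determines.\<close>
  define V where "V \<omega> = of_bool (A j \<omega> = a) * (of_bool (A i \<omega> = a) * (Y i \<omega> - y (X i \<omega>) a)) * (X i \<omega> \<bullet> X j \<omega>)" for \<omega>
  have Xi: "X i \<in> measurable (past j) context_algebra"
    using ij by (intro measurable_context_algebraI round_measurable_past space_past) auto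
  have V: "V \<in> borel_measurable ?G"
    unfolding V_def[abs_def]
    by (intro borel_measurable_times borel_measurable_inner XA chosen_measurable past round_measurable_past
        borel_measurable_diff ij measurable_compose[OF Xi y_measurable])
  have \<eta>: "\<eta> j \<in> borel_measurable ?F"
    by (rule measurable_vimage_algebra1) simp
  have eq: "AE \<omega> in P. noise_term a i \<omega> \<bullet> noise_term a j \<omega> = \<eta> j \<omega> * V \<omega>"
    using reward_eq[OF i] by eventually_elim (auto simp: noise_term_def V_def)
  have V_P: "V \<in> borel_measurable P"
    using measurable_from_subalg[of P ?G V borel] indep_setD_ev2[OF indep] V by (simp add: subalgebra_def)
  \<comment> \<open>\<open>V\<close> contains the reward and may be unbounded, so integrability is
    taken from the square integrability of the two noise terms.\<close>
  have "integrable P (\<lambda>\<omega>. noise_term a i \<omega> \<bullet> noise_term a j \<omega>)"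
    by (intro integrable_inner_of_square noise_measurable noise_square i j)
  then have int: "integrable P (\<lambda>\<omega>. \<eta> j \<omega> * V \<omega>)"
    by (rule integrable_cong_AE_imp)
       (use eq in \<open>auto intro: borel_measurable_times borel_measurable_integrable \<eta>_mean j V_P\<close>)
  have "(\<integral>\<omega>. noise_term a i \<omega> \<bullet> noise_term a j \<omega> \<partial>P) = (\<integral>\<omega>. \<eta> j \<omega> * V \<omega> \<partial>P)"
    by (intro integral_cong_AE eq borel_measurable_inner noise_measurable i j
        borel_measurable_times borel_measurable_integrable \<eta>_mean V_P)
  also have "\<dots> = (\<integral>\<omega>. (\<integral>u. u * V \<omega> \<partial>distr P borel (\<eta> j)) \<partial>P)"
  proof -
    have "(\<lambda>z. fst z * snd z :: real) \<in> borel_measurable (borel \<Otimes>\<^sub>M borel)"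
      by (intro borel_measurable_times measurable_fst measurable_snd)
    from integral_indep_set[OF indep \<eta> V _ _ this] int show ?thesis by simp
  qed
  also have "\<dots> = 0"
  proof -
    have "(\<integral>u. u \<partial>distr P borel (\<eta> j)) = 0"
      using \<eta>_mean[OF j] by (subst integral_distr) (auto intro: borel_measurable_integrable)
    then show ?thesis by simp
  qed
  finally show ?thesis .
qed

lemma noise_sum_bound:
  "integrable P (\<lambda>\<omega>. norm (\<Sum>\<tau>\<in>{1..<t}. noise_term a \<tau> \<omega>))"
  "(\<integral>\<omega>. norm (\<Sum>\<tau>\<in>{1..<t}. noise_term a \<tau> \<omega>) \<partial>P) \<le> M * \<sigma>\<eta> * sqrt (real (t - 1))"
proof -
  note * = noise_measurable noise_square noise_orthogonal
  show "integrable P (\<lambda>\<omega>. norm (\<Sum>\<tau>\<in>{1..<t}. noise_term a \<tau> \<omega>))"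
    by (rule orthogonal_sum_bound(1)[where V="(M * \<sigma>\<eta>)\<^sup>2"]) (auto intro!: *)
  have "(\<integral>\<omega>. norm (\<Sum>\<tau>\<in>{1..<t}. noise_term a \<tau> \<omega>) \<partial>P) \<le> sqrt (real (card {1..<t}) * (M * \<sigma>\<eta>)\<^sup>2)"
    by (rule orthogonal_sum_bound(2)) (auto intro!: *)
  then show "(\<integral>\<omega>. norm (\<Sum>\<tau>\<in>{1..<t}. noise_term a \<tau> \<omega>) \<partial>P) \<le> M * \<sigma>\<eta> * sqrt (real (t - 1))"
    using pos by (simp add: real_sqrt_mult mult.commute)
qed

subsection \<open>The population fixed point\<close>

abbreviation second_moment :: "real^'d \<Rightarrow> real^'d^'d" where
  "second_moment x \<equiv> outer x x"

text \<open>The summand of the normal equations at \<open>v\<close>. Its drift is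
  \<open>b_a(\<beta>) - \<Sigma>_a(\<beta>) v\<close> by \<open>drift_residual\<close>, so a
  vanishing drift says that \<open>v\<close> solves the population equations for the policy of
  \<open>\<beta>\<close>.\<close>

definition residual :: "'k \<Rightarrow> real^'d \<Rightarrow> real^'d \<Rightarrow> real^'d" where
  "residual a v x = (y x a - x \<bullet> v) *\<^sub>R x"

lemma second_moment_measurable: "second_moment \<in> borel_measurable context_algebra"
  by (intro measurable_contextD outer_measurable) simp

lemma second_moment_bound: "norm x \<le> M \<Longrightarrow> norm (second_moment x) \<le> M\<^sup>2"
  by (simp add: norm_outer_self power_mono)

lemma residual_measurable: "residual a v \<in> borel_measurable context_algebra"
  unfolding residual_def[abs_def]
  by (intro borel_measurable_scaleR borel_measurable_diff y_measurable borel_measurable_inner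
      measurable_contextD borel_measurable_const measurable_ident_sets[OF refl])

lemma residual_bound:
  assumes "x \<in> S" "norm x \<le> M" "norm v \<le> R"
  shows "norm (residual a v x) \<le> M * (Ry + M * R)"
proof -
  have "\<bar>x \<bullet> v\<bar> \<le> M * R"
    using Cauchy_Schwarz_ineq2[of x v] mult_mono[OF assms(2,3)] pos by simp
  then have "\<bar>y x a - x \<bullet> v\<bar> \<le> Ry + M * R"
    using y_bounded[OF assms(1,2), of a] by linarith
  then have "\<bar>y x a - x \<bullet> v\<bar> * norm x \<le> (Ry + M * R) * M"
    using assms(2) by (intro mult_mono) auto
  then show ?thesis by (simp add: residual_def mult.commute)
qed

lemma residual_bound_self:
  "x \<in> S \<Longrightarrow> norm x \<le> M \<Longrightarrow> norm (residual a v x) \<le> M * (Ry + M * norm v)"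
  by (rule residual_bound) auto

lemma bounded_linear_matrix_vector: "bounded_linear (\<lambda>Q. Q *v w)" for w :: "real^'n"
  by (rule linear_conv_bounded_linear[THEN iffD1])
     (auto intro!: linearI simp: matrix_vector_mult_add_rdistrib scaleR_matrix_vector_assoc)

lemma covariance_coercive: "\<sigma>min\<^sup>2 * (norm v)\<^sup>2 \<le> (\<integral>x. (x \<bullet> v)\<^sup>2 \<partial>context_law)"
proof -
  let ?R = "integral\<^sup>L P (\<lambda>\<omega>. second_moment (X 1 \<omega>))"
  have int: "integrable P (\<lambda>\<omega>. second_moment (X 1 \<omega>))"
  proof (rule integrable_const_bound)
    show "AE \<omega> in P. norm (second_moment (X 1 \<omega>)) \<le> M\<^sup>2"
      using X_bounded[OF order_refl] by eventually_elim (rule second_moment_bound)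
  qed (intro outer_measurable X_borel_measurable order_refl)
  have lin: "bounded_linear (\<lambda>Q. v \<bullet> (Q *v v))"
    by (rule bounded_linear_compose[OF bounded_linear_inner_right bounded_linear_matrix_vector])
  have "(\<integral>\<omega>. (X 1 \<omega> \<bullet> v)\<^sup>2 \<partial>P) = (\<integral>\<omega>. v \<bullet> (second_moment (X 1 \<omega>) *v v) \<partial>P)"
    by (simp add: outer_mult_vec power2_eq_square inner_commute)
  also have "\<dots> = v \<bullet> (?R *v v)"
    by (rule integral_bounded_linear[OF lin int])
  finally have eq: "(\<integral>\<omega>. (X 1 \<omega> \<bullet> v)\<^sup>2 \<partial>P) = v \<bullet> (?R *v v)" .
  have "0 \<le> v \<bullet> ((?R - mat (\<sigma>min\<^sup>2)) *v v)"
    using X_cov by (simp add: loewner_le_def pos_semidef_def)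
  then have "\<sigma>min\<^sup>2 * (norm v)\<^sup>2 \<le> v \<bullet> (?R *v v)"
    by (simp add: matrix_vector_mult_diff_rdistrib inner_diff_right mat_mult_vec power2_norm_eq_inner)
  also have "\<dots> = (\<integral>x. (x \<bullet> v)\<^sup>2 \<partial>context_law)"
    unfolding eq[symmetric] context_law_def
  proof (rule integral_distr[symmetric])
    show "(\<lambda>x. (x \<bullet> v)\<^sup>2) \<in> borel_measurable context_algebra"
      by (intro measurable_contextD borel_measurable_power borel_measurable_inner borel_measurable_const measurable_ident_sets[OF refl])
  qed (intro X_measurable order_refl)
  finally show ?thesis .
qed

definition eigmin :: real where "eigmin = \<pi>min * \<sigma>min\<^sup>2"

lemma eigmin_pos: "0 < eigmin"
  using \<pi>min pos by (simp add: eigmin_def)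

lemma drift_second_moment_form:
  "v \<bullet> (drift a second_moment \<beta> *v v) = (\<integral>x. policy x \<beta> $ a * (x \<bullet> v)\<^sup>2 \<partial>context_law)"
proof -
  have lin: "bounded_linear (\<lambda>Q. v \<bullet> (Q *v v))"
    by (rule bounded_linear_compose[OF bounded_linear_inner_right bounded_linear_matrix_vector])
  have "v \<bullet> (drift a second_moment \<beta> *v v)
      = (\<integral>x. v \<bullet> (((policy x \<beta> $ a) *\<^sub>R second_moment x) *v v) \<partial>context_law)"
    unfolding drift_def
    by (rule integral_bounded_linear[OF lin policy_integrable, symmetric])
       (auto intro: second_moment_measurable second_moment_bound)
  then show ?thesis
    by (simp add: scaleR_matrix_vector_assoc[symmetric] outer_mult_vec power2_eq_square inner_commute mult.assoc)
qed

lemma square_integrable_law: "integrable context_law (\<lambda>x. (x \<bullet> v)\<^sup>2)"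
  "AE x in context_law. (x \<bullet> v)\<^sup>2 \<le> M\<^sup>2 * (norm v)\<^sup>2"
proof -
  show ae: "AE x in context_law. (x \<bullet> v)\<^sup>2 \<le> M\<^sup>2 * (norm v)\<^sup>2"
    using AE_law
  proof eventually_elim
    case (elim x)
    then have "\<bar>x \<bullet> v\<bar> \<le> M * norm v"
      using Cauchy_Schwarz_ineq2[of x v] mult_right_mono[of "norm x" M "norm v"] by simp
    then show ?case using power_mono[of "\<bar>x \<bullet> v\<bar>" "M * norm v" 2] by (simp add: power_mult_distrib)
  qed
  have "(\<lambda>x. (x \<bullet> v)\<^sup>2) \<in> borel_measurable context_law"
    unfolding measurable_law
    by (intro measurable_contextD borel_measurable_power borel_measurable_inner borel_measurable_const measurable_ident_sets[OF refl])
  with ae show "integrable context_law (\<lambda>x. (x \<bullet> v)\<^sup>2)"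
    by (intro law.integrable_const_bound[where B="M\<^sup>2 * (norm v)\<^sup>2"]) auto
qed

lemma drift_coercive: "eigmin * (norm v)\<^sup>2 \<le> v \<bullet> (drift a second_moment \<beta> *v v)"
proof -
  have "eigmin * (norm v)\<^sup>2 \<le> \<pi>min * (\<integral>x. (x \<bullet> v)\<^sup>2 \<partial>context_law)"
    using mult_left_mono[OF covariance_coercive[of v], of \<pi>min] \<pi>min by (simp add: eigmin_def mult.assoc)
  also have "\<dots> = (\<integral>x. \<pi>min * (x \<bullet> v)\<^sup>2 \<partial>context_law)" by simp
  also have "\<dots> \<le> (\<integral>x. policy x \<beta> $ a * (x \<bullet> v)\<^sup>2 \<partial>context_law)"
  proof (rule integral_mono)
    show "integrable context_law (\<lambda>x. policy x \<beta> $ a * (x \<bullet> v)\<^sup>2)"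
    proof (rule Bochner_Integration.integrable_bound[OF square_integrable_law(1)])
      show "(\<lambda>x. policy x \<beta> $ a * (x \<bullet> v)\<^sup>2) \<in> borel_measurable context_law"
        unfolding measurable_law
        by (intro borel_measurable_times policy_measurable' measurable_contextD borel_measurable_power
            borel_measurable_inner borel_measurable_const measurable_ident_sets[OF refl])
      show "AE x in context_law. norm (policy x \<beta> $ a * (x \<bullet> v)\<^sup>2) \<le> norm ((x \<bullet> v)\<^sup>2)"
        using policy_bounds by (auto simp: abs_mult intro!: mult_left_le_one_le)
    qed
  qed (use square_integrable_law policy_bounds in \<open>auto intro: mult_right_mono\<close>)
  finally show ?thesis by (simp add: drift_second_moment_form)
qed

text \<open>Any \<open>\<Sigma>_a(\<beta>)\<close> on a unit vector lies between the two constants;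
  action and parameter are arbitrary. This later absorbs the smaller part of
  \<open>residual_size\<close>.\<close>

lemma eigmin_le: "eigmin \<le> M\<^sup>2"
proof -
  obtain v :: "real^'d" where v: "norm v = 1"
    using vector_choose_size[of 1] by auto
  have "eigmin \<le> v \<bullet> (drift undefined second_moment 0 *v v)"
    using drift_coercive[of v undefined 0] v by simp
  also have "\<dots> \<le> norm (drift undefined second_moment 0) * norm v * norm v"
    using norm_cauchy_schwarz[of v "drift undefined second_moment 0 *v v"]
      norm_matrix_vector_le[of "drift undefined second_moment 0" v] v by simp
  also have "\<dots> \<le> M\<^sup>2"
    using v drift_norm_le[OF second_moment_measurable second_moment_bound, of undefined 0] by simp
  finally show ?thesis .
qed

lemma drift_residual:
  "drift a (residual a v) \<beta> = drift a (residual a 0) \<beta> - drift a second_moment \<beta> *v v"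
proof -
  note int = policy_integrable[OF residual_measurable residual_bound_self]
    policy_integrable[OF second_moment_measurable second_moment_bound]
  have "drift a second_moment \<beta> *v v = (\<integral>x. ((policy x \<beta> $ a) *\<^sub>R second_moment x) *v v \<partial>context_law)"
    unfolding drift_def by (rule integral_bounded_linear[OF bounded_linear_matrix_vector int(2), symmetric])
  moreover have "integrable context_law (\<lambda>x. ((policy x \<beta> $ a) *\<^sub>R second_moment x) *v v)"
    by (rule integrable_bounded_linear[OF bounded_linear_matrix_vector int(2)])
  ultimately have "drift a (residual a 0) \<beta> - drift a second_moment \<beta> *v v
      = (\<integral>x. (policy x \<beta> $ a) *\<^sub>R residual a 0 x - ((policy x \<beta> $ a) *\<^sub>R second_moment x) *v v \<partial>context_law)"
    using int(1) by (simp add: drift_def)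
  also have "\<dots> = drift a (residual a v) \<beta>"
    unfolding drift_def residual_def
    by (intro Bochner_Integration.integral_cong refl)
       (simp add: scaleR_matrix_vector_assoc[symmetric] outer_mult_vec algebra_simps)
  finally show ?thesis by simp
qed

text \<open>The a priori bound on \<open>\<Sigma>_a(\<beta>)^(-1) b_a(\<beta>)\<close>, valid for
  every \<open>\<beta>\<close>: \<open>b_a(\<beta>)\<close> has norm at most \<open>M * Ry\<close>.
  Accordingly \<open>residual_size\<close> bounds the residuals at all \<open>v\<close> of norm at
  most \<open>radius\<close>.\<close>

definition radius :: real where "radius = M * Ry / eigmin"
definition residual_size :: real where "residual_size = M * (Ry + M * radius)"

text \<open>In 16, one factor 4 is that of the Lipschitz constant \<open>4 * M / \<gamma>\<close>
  and the other produces the contraction factor 1/4; \<open>CARD('k)\<close> comes from summing over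
  actions. Since \<open>residual_size * eigmin \<le> 2 * M^3 * Ry\<close>, the temperature condition
  carries the number 32.\<close>

lemma contraction_constant: "16 * M * residual_size * real CARD('k) \<le> \<gamma> * eigmin"
proof -
  have "M * Ry * eigmin \<le> M * Ry * M\<^sup>2"
    using eigmin_le pos by (intro mult_left_mono) auto
  moreover have "residual_size * eigmin = M * Ry * eigmin + M * Ry * M\<^sup>2"
    using eigmin_pos by (simp add: residual_size_def radius_def field_simps power2_eq_square)
  ultimately have "residual_size * eigmin \<le> 2 * M^3 * Ry"
    by (simp add: power2_eq_square power3_eq_cube mult_ac)
  then have "16 * M * real CARD('k) * (residual_size * eigmin) \<le> 16 * M * real CARD('k) * (2 * M^3 * Ry)"
    using pos by (intro mult_left_mono) auto
  also have "\<dots> = 32 * M^4 * Ry * real CARD('k)" by (simp add: eval_nat_numeral)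
  also have "\<dots> \<le> \<gamma> * eigmin * eigmin" using temperature by (simp add: eigmin_def power2_eq_square)
  finally have "(16 * M * residual_size * real CARD('k)) * eigmin \<le> (\<gamma> * eigmin) * eigmin"
    by (simp add: mult_ac)
  then show ?thesis using eigmin_pos by simp
qed

lemma population_fixed_point:
  "\<exists>\<theta> :: real^'d^'k. \<forall>a. norm (\<theta> $ a) \<le> radius \<and> drift a (residual a (\<theta> $ a)) \<theta> = 0"
proof -
  define T :: "real^'d^'k \<Rightarrow> real^'d^'k" where
    "T \<beta> = (\<chi> a. matrix_inv (drift a second_moment \<beta>) *v drift a (residual a 0) \<beta>)" for \<beta>
  have inv: "invertible (drift a second_moment \<beta>)" for a \<beta>
    by (rule coercive_invertible[OF eigmin_pos drift_coercive])
  have T_eq: "drift a (residual a (T \<beta> $ a)) \<beta> = 0" for a \<beta>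
    by (subst drift_residual) (simp add: T_def matrix_inv_solves[OF inv])
  have T_bound: "norm (T \<beta> $ a) \<le> radius" for a \<beta>
  proof -
    have "eigmin * norm (T \<beta> $ a) \<le> norm (drift a second_moment \<beta> *v (T \<beta> $ a))"
      by (rule coercive_norm_le[OF drift_coercive])
    also have "drift a second_moment \<beta> *v (T \<beta> $ a) = drift a (residual a 0) \<beta>"
      by (simp add: T_def matrix_inv_solves[OF inv])
    also have "norm \<dots> \<le> M * (Ry + M * norm (0 :: real^'d))"
      by (rule drift_norm_le[OF residual_measurable residual_bound_self])
    finally show ?thesis using eigmin_pos by (simp add: radius_def field_simps)
  qed
  \<comment> \<open>No perturbation of inverse matrices is required:
    \<open>\<Sigma>_a(\<beta>) (T \<beta> - T \<beta>')_a\<close> is the drift at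
    \<open>\<beta>\<close> of the residual for \<open>T \<beta>'\<close>, and that drift vanishes at
    \<open>\<beta>'\<close>. Only the change of policy between \<open>\<beta>\<close> and
    \<open>\<beta>'\<close> is left.\<close>
  have T_diff: "eigmin * norm (T \<beta> $ a - T \<beta>' $ a) \<le> 4 * M / \<gamma> * norm (\<beta> - \<beta>') * residual_size" for a \<beta> \<beta>'
  proof -
    have "eigmin * norm (T \<beta> $ a - T \<beta>' $ a) \<le> norm (drift a second_moment \<beta> *v (T \<beta> $ a - T \<beta>' $ a))"
      by (rule coercive_norm_le[OF drift_coercive])
    also have "drift a second_moment \<beta> *v (T \<beta> $ a - T \<beta>' $ a) = drift a (residual a (T \<beta>' $ a)) \<beta>"
      using T_eq[of a \<beta>] drift_residual[of a "T \<beta>' $ a" \<beta>] drift_residual[of a "T \<beta> $ a" \<beta>]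
      by (simp add: matrix_vector_mult_diff_distrib)
    also have "\<dots> = drift a (residual a (T \<beta>' $ a)) \<beta> - drift a (residual a (T \<beta>' $ a)) \<beta>'"
      by (simp add: T_eq)
    also have "norm \<dots> \<le> 4 * M / \<gamma> * norm (\<beta> - \<beta>') * residual_size"
    proof (rule drift_diff_le[OF residual_measurable])
      show "norm (residual a (T \<beta>' $ a) x) \<le> residual_size" if "x \<in> S" "norm x \<le> M" for x
        unfolding residual_size_def using that T_bound by (rule residual_bound)
      show "\<bar>policy x \<beta> $ a - policy x \<beta>' $ a\<bar> \<le> 4 * M / \<gamma> * norm (\<beta> - \<beta>')" if "norm x \<le> M" for x
        using that Finite_Cartesian_Product.norm_nth_le[of "\<beta> - \<beta>'"]
        by (intro clipped_boltzmann_lipschitz \<pi>min pos) auto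
    qed
    finally show ?thesis .
  qed
  have "dist (T \<beta>) (T \<beta>') \<le> 1 / 4 * dist \<beta> \<beta>'" for \<beta> \<beta>'
  proof -
    \<comment> \<open>The Euclidean norm over actions is bounded by the sum, which costs the factor
      \<open>CARD('k)\<close>.\<close>
    have "eigmin * norm (T \<beta> - T \<beta>') \<le> eigmin * (\<Sum>a\<in>UNIV. norm (T \<beta> $ a - T \<beta>' $ a))"
      using eigmin_pos L2_set_le_sum[of UNIV "\<lambda>a. norm ((T \<beta> - T \<beta>') $ a)"]
      by (intro mult_left_mono) (auto simp: norm_vec_def)
    also have "\<dots> \<le> (\<Sum>a\<in>(UNIV :: 'k set). 4 * M / \<gamma> * norm (\<beta> - \<beta>') * residual_size)"
      unfolding sum_distrib_left by (intro sum_mono T_diff)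
    also have "\<dots> = (16 * M * residual_size * real CARD('k)) * (norm (\<beta> - \<beta>') / (4 * \<gamma>))"
      using pos by (simp add: field_simps)
    also have "\<dots> \<le> (\<gamma> * eigmin) * (norm (\<beta> - \<beta>') / (4 * \<gamma>))"
      using pos by (intro mult_right_mono contraction_constant) auto
    also have "\<dots> = eigmin * (1 / 4 * norm (\<beta> - \<beta>'))"
      using pos by (simp add: field_simps)
    finally show ?thesis using eigmin_pos by (simp add: dist_norm)
  qed
  then obtain \<theta> where "T \<theta> = \<theta>"
    using banach_fix_type[of "1 / 4" T] by auto
  with T_eq[of _ \<theta>] T_bound[of \<theta>] show ?thesis by auto
qed

subsection \<open>Convergence to the fixed point\<close>

context
  fixes \<theta> :: "real^'d^'k"
  assumes \<theta>_norm: "\<And>a. norm (\<theta> $ a) \<le> radius"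
    and \<theta>_fixed: "\<And>a. drift a (residual a (\<theta> $ a)) \<theta> = 0"
begin

text \<open>At distance \<open>cap\<close> the Lipschitz bound on the policy reaches \<open>1\<close>, so truncating there loses nothing.\<close>

definition cap :: real where "cap = \<gamma> / (4 * M)"

text \<open>A sum over all actions, because the policy for one action reacts to the estimates of
  every action. Truncating each block makes it bounded by \<open>CARD('k) * cap\<close>.\<close>

definition deviation :: "real^'d^'k \<Rightarrow> real" where
  "deviation \<beta> = (\<Sum>a\<in>UNIV. min cap (norm (\<beta> $ a - \<theta> $ a)))"

lemma cap_pos: "0 < cap"
  using pos by (simp add: cap_def)

lemma deviation_bounds: "0 \<le> deviation \<beta>" "deviation \<beta> \<le> real CARD('k) * cap"
  "min cap (norm (\<beta> $ a - \<theta> $ a)) \<le> deviation \<beta>"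
proof -
  show "0 \<le> deviation \<beta>"
    unfolding deviation_def using cap_pos by (intro sum_nonneg) auto
  show "deviation \<beta> \<le> real CARD('k) * cap"
    unfolding deviation_def by (rule sum_bounded_above) simp
  show "min cap (norm (\<beta> $ a - \<theta> $ a)) \<le> deviation \<beta>"
    unfolding deviation_def using cap_pos by (intro member_le_sum) auto
qed

text \<open>If some block is farther away than \<open>cap\<close>, the right side is at least 1, and
  probabilities differ by at most 1. Otherwise nothing is truncated and the Lipschitz constant
  \<open>4 * M / \<gamma>\<close> is \<open>1 / cap\<close>.\<close>

lemma policy_deviation:
  assumes "norm x \<le> M"
  shows "\<bar>policy x \<beta> $ a - policy x \<theta> $ a\<bar> \<le> deviation \<beta> / cap"
proof (cases "\<exists>b. cap < norm (\<beta> $ b - \<theta> $ b)")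
  case True
  then obtain b where "cap < norm (\<beta> $ b - \<theta> $ b)" by blast
  then have "cap \<le> deviation \<beta>" using deviation_bounds(3)[of \<beta> b] by simp
  then have "1 \<le> deviation \<beta> / cap" using cap_pos by simp
  then show ?thesis
    using policy_bounds(2,3)[of x \<beta> a] policy_bounds(2,3)[of x \<theta> a] by linarith
next
  case False
  then have "norm (\<beta> $ b - \<theta> $ b) \<le> deviation \<beta>" for b
    using False deviation_bounds(3)[of \<beta> b] by (auto simp: not_less min_absorb2)
  from clipped_boltzmann_lipschitz[OF \<pi>min pos(5) assms this]
  show ?thesis using pos by (simp add: cap_def field_simps)
qed

lemma drift_deviation: "norm (drift a (residual a (\<theta> $ a)) \<beta>) \<le> deviation \<beta> / cap * residual_size"
proof -
  have "norm (drift a (residual a (\<theta> $ a)) \<beta> - drift a (residual a (\<theta> $ a)) \<theta>) \<le> deviation \<beta> / cap * residual_size"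
    by (rule drift_diff_le[OF residual_measurable])
       (auto simp: residual_size_def intro: residual_bound \<theta>_norm policy_deviation)
  then show ?thesis by (simp add: \<theta>_fixed)
qed

lemma truncated_error_integrable:
  assumes "t \<ge> 1"
  shows "integrable P (\<lambda>\<omega>. min cap (norm (\<beta>hat t \<omega> $ a - \<theta> $ a)))"
proof (rule integrable_const_bound[where B=cap])
  have "(\<lambda>\<omega>. \<beta>hat t \<omega> $ a - \<theta> $ a) \<in> borel_measurable P"
    by (rule borel_measurable_diff[OF borel_measurable_vec_nth[OF \<beta>hat_measurable[OF assms]] borel_measurable_const])
  then show "(\<lambda>\<omega>. min cap (norm (\<beta>hat t \<omega> $ a - \<theta> $ a))) \<in> borel_measurable P"
    by measurable
qed (use cap_pos in auto)

lemma deviation_integrable: "t \<ge> 1 \<Longrightarrow> integrable P (\<lambda>\<omega>. deviation (\<beta>hat t \<omega>))"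
  unfolding deviation_def by (intro Bochner_Integration.integrable_sum truncated_error_integrable)

lemma deviation_measurable: "t \<ge> 1 \<Longrightarrow> (\<lambda>\<omega>. deviation (\<beta>hat t \<omega>)) \<in> borel_measurable P"
  by (rule borel_measurable_integrable[OF deviation_integrable])

text \<open>
  The Gram matrix \<open>G\<close> dominates \<open>(n * eigmin - norm W) I\<close>, where \<open>W\<close> is its centered part.
  Since the truncated error is at most \<open>cap\<close>, the term with \<open>norm W\<close> can be moved to the right
  even where \<open>n * eigmin - norm W\<close> is negative.
\<close>

lemma truncated_error_bound:
  assumes t: "t \<ge> 1"
  shows "AE \<omega> in P. real (t - 1) * eigmin * min cap (norm (\<beta>hat t \<omega> $ a - \<theta> $ a))
    \<le> residual_size / cap * (\<Sum>\<tau>\<in>{1..<t}. deviation (\<beta>hat \<tau> \<omega>))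
      + norm (\<Sum>\<tau>\<in>{1..<t}. centered a (residual a (\<theta> $ a)) \<tau> \<omega>)
      + norm (\<Sum>\<tau>\<in>{1..<t}. noise_term a \<tau> \<omega>)
      + lam * norm (\<theta> $ a)
      + cap * norm (\<Sum>\<tau>\<in>{1..<t}. centered a second_moment \<tau> \<omega>)"
proof -
  have "AE \<omega> in P. \<forall>\<tau>\<in>{1..<t}. Y \<tau> \<omega> = y (X \<tau> \<omega>) (A \<tau> \<omega>) + \<eta> \<tau> \<omega>"
    by (intro AE_finite_allI) (auto intro: reward_eq)
  then show ?thesis
  proof eventually_elim
    case (elim \<omega>)
    let ?I = "{1..<t}" and ?n = "real (t - 1)"
    let ?Z = "\<Sum>\<tau>\<in>?I. centered a (residual a (\<theta> $ a)) \<tau> \<omega>"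
      and ?N = "\<Sum>\<tau>\<in>?I. noise_term a \<tau> \<omega>"
      and ?W = "\<Sum>\<tau>\<in>?I. centered a second_moment \<tau> \<omega>"
      and ?H = "\<Sum>\<tau>\<in>?I. drift a (residual a (\<theta> $ a)) (\<beta>hat \<tau> \<omega>)"
      and ?L = "\<Sum>\<tau>\<in>?I. drift a second_moment (\<beta>hat \<tau> \<omega>)"
      and ?Q = "\<Sum>\<tau>\<in>?I. of_bool (A \<tau> \<omega> = a) *\<^sub>R second_moment (X \<tau> \<omega>)"
    define G where "G = mat lam + ?Q"
    define v where "v = \<beta>hat t \<omega> $ a - \<theta> $ a"
    have sum_mult: "sum f J *v w = (\<Sum>\<tau>\<in>J. f \<tau> *v w)" for f :: "nat \<Rightarrow> real^'d^'d" and J w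
      by (induction J rule: infinite_finite_induct) (simp_all add: matrix_vector_mult_add_rdistrib)
    have "G *v (\<beta>hat t \<omega> $ a) = (\<Sum>\<tau>\<in>?I. of_bool (A \<tau> \<omega> = a) *\<^sub>R (Y \<tau> \<omega> *\<^sub>R X \<tau> \<omega>))"
      unfolding G_def by (simp add: ridge_def matrix_inv_solves[OF gram_invertible])
    moreover have "G *v (\<theta> $ a) = lam *\<^sub>R (\<theta> $ a) + (\<Sum>\<tau>\<in>?I. of_bool (A \<tau> \<omega> = a) *\<^sub>R ((X \<tau> \<omega> \<bullet> \<theta> $ a) *\<^sub>R X \<tau> \<omega>))"
      by (simp add: G_def matrix_vector_mult_add_rdistrib mat_mult_vec sum_mult scaleR_matrix_vector_assoc[symmetric] outer_mult_vec)
    ultimately have "G *v v = (\<Sum>\<tau>\<in>?I. of_bool (A \<tau> \<omega> = a) *\<^sub>R (Y \<tau> \<omega> *\<^sub>R X \<tau> \<omega>)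
        - of_bool (A \<tau> \<omega> = a) *\<^sub>R ((X \<tau> \<omega> \<bullet> \<theta> $ a) *\<^sub>R X \<tau> \<omega>)) - lam *\<^sub>R (\<theta> $ a)"
      by (simp add: v_def matrix_vector_mult_diff_distrib sum_subtractf)
    \<comment> \<open>In a round with action \<open>a\<close> the reward minus the prediction of
      \<open>\<theta>\<close>, times the context, is the residual plus noise; the residual is then
      split into its drift and its martingale part. In other rounds drift and centered term
      cancel.\<close>
    also have "(\<Sum>\<tau>\<in>?I. of_bool (A \<tau> \<omega> = a) *\<^sub>R (Y \<tau> \<omega> *\<^sub>R X \<tau> \<omega>)
        - of_bool (A \<tau> \<omega> = a) *\<^sub>R ((X \<tau> \<omega> \<bullet> \<theta> $ a) *\<^sub>R X \<tau> \<omega>))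
      = (\<Sum>\<tau>\<in>?I. centered a (residual a (\<theta> $ a)) \<tau> \<omega> + drift a (residual a (\<theta> $ a)) (\<beta>hat \<tau> \<omega>) + noise_term a \<tau> \<omega>)"
      using elim by (intro sum.cong refl) (auto simp: centered_def residual_def noise_term_def algebra_simps)
    also have "\<dots> = ?Z + ?H + ?N"
      by (simp add: sum.distrib)
    finally have Gv: "G *v v = ?Z + ?H + ?N - lam *\<^sub>R (\<theta> $ a)" .
    have "norm ?H \<le> (\<Sum>\<tau>\<in>?I. deviation (\<beta>hat \<tau> \<omega>) / cap * residual_size)"
      by (intro sum_norm_le drift_deviation)
    also have "\<dots> = residual_size / cap * (\<Sum>\<tau>\<in>?I. deviation (\<beta>hat \<tau> \<omega>))"
      by (simp add: sum_distrib_left sum_distrib_right mult.commute)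
    finally have H: "norm ?H \<le> residual_size / cap * (\<Sum>\<tau>\<in>?I. deviation (\<beta>hat \<tau> \<omega>))" .
    have "norm (G *v v) \<le> norm ?Z + norm ?H + norm ?N + norm (lam *\<^sub>R (\<theta> $ a))"
      unfolding Gv by (intro norm_triangle_le_diff norm_triangle_le order_refl add_mono)
    then have upper: "norm (G *v v) \<le> residual_size / cap * (\<Sum>\<tau>\<in>?I. deviation (\<beta>hat \<tau> \<omega>))
        + norm ?Z + norm ?N + lam * norm (\<theta> $ a)"
      using H pos by simp
    have "?Q = ?W + ?L"
      by (simp add: centered_def sum_subtractf)
    then have form: "v \<bullet> (G *v v) = lam * (v \<bullet> v) + v \<bullet> (?W *v v) + v \<bullet> (?L *v v)"
      by (simp add: G_def matrix_vector_mult_add_rdistrib mat_mult_vec inner_add_right)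
    have "\<bar>v \<bullet> (?W *v v)\<bar> \<le> norm v * (norm ?W * norm v)"
      using Cauchy_Schwarz_ineq2[of v "?W *v v"] mult_left_mono[OF norm_matrix_vector_le[of ?W v], of "norm v"] by simp
    then have W: "- (norm ?W * (norm v)\<^sup>2) \<le> v \<bullet> (?W *v v)"
      by (simp add: power2_eq_square mult_ac)
    \<comment> \<open>Each round has its own estimate, but \<open>eigmin\<close> is the same for all
      of them, so the bounds add up.\<close>
    have "(\<Sum>\<tau>\<in>?I. eigmin * (norm v)\<^sup>2) \<le> v \<bullet> (?L *v v)"
      unfolding sum_mult inner_sum_right by (intro sum_mono drift_coercive)
    then have "?n * eigmin * (norm v)\<^sup>2 \<le> v \<bullet> (?L *v v)" by simp
    have "(?n * eigmin - norm ?W) * (norm v)\<^sup>2 \<le> v \<bullet> (G *v v)"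
    proof -
      have "0 \<le> lam * (v \<bullet> v)" using pos by simp
      with W form \<open>?n * eigmin * (norm v)\<^sup>2 \<le> v \<bullet> (?L *v v)\<close> show ?thesis
        unfolding left_diff_distrib by linarith
    qed
    then have lower: "(?n * eigmin - norm ?W) * norm v \<le> norm (G *v v)"
      by (rule coercive_norm_le)
    have "(?n * eigmin - norm ?W) * min cap (norm v) \<le> norm (G *v v)"
    proof (cases "0 \<le> ?n * eigmin - norm ?W")
      case True
      then have "(?n * eigmin - norm ?W) * min cap (norm v) \<le> (?n * eigmin - norm ?W) * norm v"
        by (intro mult_left_mono) auto
      with lower show ?thesis by linarith
    next
      case False
      then have "(?n * eigmin - norm ?W) * min cap (norm v) \<le> 0"
        using cap_pos by (intro mult_nonpos_nonneg) auto
      then show ?thesis using norm_ge_zero[of "G *v v"] by linarith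
    qed
    moreover have "norm ?W * min cap (norm v) \<le> cap * norm ?W"
      using mult_left_mono[of "min cap (norm v)" cap "norm ?W"] by (simp add: mult.commute)
    ultimately have "?n * eigmin * min cap (norm v) \<le> norm (G *v v) + cap * norm ?W"
      by (simp add: left_diff_distrib)
    with upper show ?case unfolding v_def by linarith
  qed
qed

text \<open>The four summands come from the centered residuals, the noise, the ridge penalty and the
  centered Gram matrix, in this order; all are summed over actions.\<close>

definition rate_constant :: real where
  "rate_constant = real CARD('k) * (2 * residual_size + M * \<sigma>\<eta> + lam * radius + 2 * cap * M\<^sup>2) / eigmin"

lemma size_nonneg: "0 \<le> radius" "0 \<le> residual_size" "0 \<le> rate_constant"
proof -
  show r: "0 \<le> radius" using pos eigmin_pos by (simp add: radius_def)
  then show s: "0 \<le> residual_size" using pos by (simp add: residual_size_def)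
  show "0 \<le> rate_constant"
    using r s pos eigmin_pos cap_pos by (simp add: rate_constant_def)
qed

lemma expected_error_bound:
  assumes t: "t \<ge> 2"
  shows "real (t - 1) * eigmin * (\<integral>\<omega>. min cap (norm (\<beta>hat t \<omega> $ a - \<theta> $ a)) \<partial>P)
    \<le> residual_size / cap * (\<Sum>\<tau>\<in>{1..<t}. \<integral>\<omega>. deviation (\<beta>hat \<tau> \<omega>) \<partial>P)
      + (2 * residual_size + M * \<sigma>\<eta> + lam * radius + 2 * cap * M\<^sup>2) * sqrt (real (t - 1))"
proof -
  let ?n = "real (t - 1)"
  have n: "1 \<le> ?n" using t by simp
  have res: "norm (residual a (\<theta> $ a) x) \<le> residual_size" if "x \<in> S" "norm x \<le> M" for x
    unfolding residual_size_def using that \<theta>_norm by (rule residual_bound)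
  have mom: "norm (second_moment x) \<le> M\<^sup>2" if "x \<in> S" "norm x \<le> M" for x
    using that by (intro second_moment_bound)
  note Z = centered_sum_bound[OF residual_measurable res, where t=t]
  note W = centered_sum_bound[OF second_moment_measurable mom, where t=t and a=a]
  note N = noise_sum_bound[of a t]
  let ?Z = "\<lambda>\<omega>. norm (\<Sum>\<tau>\<in>{1..<t}. centered a (residual a (\<theta> $ a)) \<tau> \<omega>)"
    and ?N = "\<lambda>\<omega>. norm (\<Sum>\<tau>\<in>{1..<t}. noise_term a \<tau> \<omega>)"
    and ?W = "\<lambda>\<omega>. norm (\<Sum>\<tau>\<in>{1..<t}. centered a second_moment \<tau> \<omega>)"
    and ?D = "\<lambda>\<omega>. \<Sum>\<tau>\<in>{1..<t}. deviation (\<beta>hat \<tau> \<omega>)"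
  have D: "integrable P ?D" by (intro Bochner_Integration.integrable_sum deviation_integrable) auto
  have "integrable P (\<lambda>\<omega>. min cap (norm (\<beta>hat t \<omega> $ a - \<theta> $ a)))"
    using t by (intro truncated_error_integrable) simp
  then have "?n * eigmin * (\<integral>\<omega>. min cap (norm (\<beta>hat t \<omega> $ a - \<theta> $ a)) \<partial>P)
      \<le> (\<integral>\<omega>. residual_size / cap * ?D \<omega> + ?Z \<omega> + ?N \<omega> + lam * norm (\<theta> $ a) + cap * ?W \<omega> \<partial>P)"
    unfolding integral_mult_right_zero[symmetric]
    using t D Z(1) N(1) W(1) truncated_error_bound[of t a]
    by (intro integral_mono_AE) auto
  also have "\<dots> = residual_size / cap * (\<integral>\<omega>. ?D \<omega> \<partial>P) + (\<integral>\<omega>. ?Z \<omega> \<partial>P) + (\<integral>\<omega>. ?N \<omega> \<partial>P)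
      + lam * norm (\<theta> $ a) + cap * (\<integral>\<omega>. ?W \<omega> \<partial>P)"
    using D Z(1) N(1) W(1) by (simp add: prob_space)
  also have "(\<integral>\<omega>. ?D \<omega> \<partial>P) = (\<Sum>\<tau>\<in>{1..<t}. \<integral>\<omega>. deviation (\<beta>hat \<tau> \<omega>) \<partial>P)"
    by (intro Bochner_Integration.integral_sum deviation_integrable) auto
  finally have *: "?n * eigmin * (\<integral>\<omega>. min cap (norm (\<beta>hat t \<omega> $ a - \<theta> $ a)) \<partial>P)
      \<le> residual_size / cap * (\<Sum>\<tau>\<in>{1..<t}. \<integral>\<omega>. deviation (\<beta>hat \<tau> \<omega>) \<partial>P) + (\<integral>\<omega>. ?Z \<omega> \<partial>P) + (\<integral>\<omega>. ?N \<omega> \<partial>P)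
      + lam * norm (\<theta> $ a) + cap * (\<integral>\<omega>. ?W \<omega> \<partial>P)" .
  \<comment> \<open>The penalty contributes a constant, absorbed in the square-root terms because
    \<open>?n\<close> is at least 1.\<close>
  have "lam * norm (\<theta> $ a) \<le> lam * radius * 1"
    using \<theta>_norm pos by simp
  also have "\<dots> \<le> lam * radius * sqrt ?n"
    using n pos size_nonneg by (intro mult_left_mono) auto
  finally have "lam * norm (\<theta> $ a) \<le> lam * radius * sqrt ?n" .
  moreover have "cap * (\<integral>\<omega>. ?W \<omega> \<partial>P) \<le> cap * (2 * M\<^sup>2 * sqrt ?n)"
    using W(2) cap_pos by (intro mult_left_mono) auto
  ultimately show ?thesis
    using * Z(2)[of a] N(2) unfolding distrib_right mult.assoc by linarith
qed

lemma deviation_recursion: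
  assumes t: "t \<ge> 2"
  shows "(\<integral>\<omega>. deviation (\<beta>hat t \<omega>) \<partial>P)
    \<le> (\<Sum>\<tau>\<in>{1..<t}. \<integral>\<omega>. deviation (\<beta>hat \<tau> \<omega>) \<partial>P) / (4 * real (t - 1)) + rate_constant / sqrt (real (t - 1))"
proof -
  let ?n = "real (t - 1)" and ?K = "real CARD('k)"
  let ?C = "2 * residual_size + M * \<sigma>\<eta> + lam * radius + 2 * cap * M\<^sup>2"
  let ?s = "\<Sum>\<tau>\<in>{1..<t}. \<integral>\<omega>. deviation (\<beta>hat \<tau> \<omega>) \<partial>P"
  have n: "0 < ?n" using t by simp
  have s: "0 \<le> ?s" by (intro sum_nonneg integral_nonneg_AE AE_I2 deviation_bounds)
  have "integrable P (\<lambda>\<omega>. min cap (norm (\<beta>hat t \<omega> $ a - \<theta> $ a)))" for a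
    using t by (intro truncated_error_integrable) simp
  then have "?n * eigmin * (\<integral>\<omega>. deviation (\<beta>hat t \<omega>) \<partial>P)
      = (\<Sum>a\<in>UNIV. ?n * eigmin * (\<integral>\<omega>. min cap (norm (\<beta>hat t \<omega> $ a - \<theta> $ a)) \<partial>P))"
    by (simp add: deviation_def sum_distrib_left)
  also have "\<dots> \<le> (\<Sum>a\<in>(UNIV :: 'k set). residual_size / cap * ?s + ?C * sqrt ?n)"
    by (intro sum_mono expected_error_bound t)
  also have "\<dots> = (?K * residual_size / cap) * ?s + ?K * ?C * sqrt ?n"
    by (simp add: algebra_simps)
  \<comment> \<open>With \<open>cap = \<gamma> / (4 * M)\<close> the feedback coefficient takes the
    shape of \<open>contraction_constant\<close>, so the recursion has the same factor 1/4 as the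
    population map.\<close>
  also have "?K * residual_size / cap = 16 * M * residual_size * ?K / (4 * \<gamma>)"
    using pos by (simp add: cap_def field_simps)
  also have "\<dots> \<le> \<gamma> * eigmin / (4 * \<gamma>)"
    using pos by (intro divide_right_mono contraction_constant) auto
  also have "\<dots> = eigmin / 4" using pos by simp
  finally have "?n * eigmin * (\<integral>\<omega>. deviation (\<beta>hat t \<omega>) \<partial>P) \<le> eigmin / 4 * ?s + ?K * ?C * sqrt ?n"
    using s by (simp add: mult_right_mono)
  then have "(\<integral>\<omega>. deviation (\<beta>hat t \<omega>) \<partial>P) \<le> (eigmin / 4 * ?s + ?K * ?C * sqrt ?n) / (?n * eigmin)"
    using n eigmin_pos by (simp add: pos_le_divide_eq mult.commute)
  also have "\<dots> = eigmin / 4 * ?s / (?n * eigmin) + ?K * ?C * sqrt ?n / (?n * eigmin)"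
    by (rule add_divide_distrib)
  also have "eigmin / 4 * ?s / (?n * eigmin) = ?s / (4 * ?n)"
    using eigmin_pos by simp
  also have "?K * ?C * sqrt ?n / (?n * eigmin) = rate_constant * (sqrt ?n / ?n)"
    by (simp add: rate_constant_def)
  also have "sqrt ?n / ?n = 1 / sqrt ?n"
    using n by (simp add: real_div_sqrt field_simps)
  finally show ?thesis by simp
qed

lemma deviation_tendsto: "(\<lambda>t. \<integral>\<omega>. deviation (\<beta>hat t \<omega>) \<partial>P) \<longlonglongrightarrow> 0"
proof (rule real_tendsto_sandwich)
  let ?B = "real CARD('k) * cap"
  have B: "0 \<le> ?B" using cap_pos by simp
  have bound: "(\<integral>\<omega>. deviation (\<beta>hat t \<omega>) \<partial>P) \<le> ?B" if "1 \<le> t" for t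
    using integral_mono_AE[OF deviation_integrable[OF that], of "\<lambda>_. ?B"] deviation_bounds(2) by (simp add: prob_space)
  show "\<forall>\<^sub>F t in sequentially. (\<integral>\<omega>. deviation (\<beta>hat t \<omega>) \<partial>P) \<le> (?B + 5 * rate_constant) / sqrt (real t)"
    using averaged_recursion_decay[OF bound B size_nonneg(3) deviation_recursion]
    by (intro eventually_sequentiallyI[of 1]) auto
  show "\<forall>\<^sub>F t in sequentially. 0 \<le> (\<integral>\<omega>. deviation (\<beta>hat t \<omega>) \<partial>P)"
    by (intro always_eventually allI integral_nonneg_AE AE_I2 deviation_bounds)
  show "(\<lambda>t. (?B + 5 * rate_constant) / sqrt (real t)) \<longlonglongrightarrow> 0"
    by (rule real_tendsto_divide_at_top[OF tendsto_const filterlim_compose[OF sqrt_at_top filterlim_real_sequentially]])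
qed simp

lemma \<beta>hat_tendsto: "tendsto_in_prob P \<beta>hat \<theta>"
  unfolding tendsto_in_prob_def
proof (intro conjI allI impI)
  show "\<forall>\<^sub>F t in sequentially. \<beta>hat t \<in> borel_measurable P"
    by (intro eventually_sequentiallyI[of 1] \<beta>hat_measurable)
  fix \<epsilon> :: real assume "0 < \<epsilon>"
  \<comment> \<open>A distance above \<open>\<epsilon>\<close> forces one of the
    \<open>CARD('k)\<close> blocks above \<open>\<epsilon> / CARD('k)\<close>; the minimum with
    \<open>cap\<close> accounts for the truncation. Markov's inequality then applies at level
    \<open>\<delta>\<close>.\<close>
  define \<delta> where "\<delta> = min cap (\<epsilon> / real CARD('k))"
  have \<delta>: "0 < \<delta>" using cap_pos \<open>0 < \<epsilon>\<close> by (simp add: \<delta>_def)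
  have large: "\<delta> \<le> deviation \<beta>" if "\<epsilon> < dist \<beta> \<theta>" for \<beta>
  proof -
    have "\<exists>a. \<epsilon> / real CARD('k) < norm (\<beta> $ a - \<theta> $ a)"
    proof (rule ccontr)
      assume "\<not> ?thesis"
      then have "(\<Sum>a\<in>(UNIV :: 'k set). norm ((\<beta> - \<theta>) $ a)) \<le> real CARD('k) * (\<epsilon> / real CARD('k))"
        by (intro sum_bounded_above) (simp add: not_less)
      moreover have "norm (\<beta> - \<theta>) \<le> (\<Sum>a\<in>UNIV. norm ((\<beta> - \<theta>) $ a))"
        unfolding norm_vec_def by (intro L2_set_le_sum) simp
      ultimately show False using that by (simp add: dist_norm)
    qed
    then obtain a where "\<epsilon> / real CARD('k) < norm (\<beta> $ a - \<theta> $ a)" ..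
    then have "\<delta> \<le> min cap (norm (\<beta> $ a - \<theta> $ a))" by (auto simp: \<delta>_def)
    also have "\<dots> \<le> deviation \<beta>" by (rule deviation_bounds)
    finally show ?thesis .
  qed
  show "(\<lambda>t. measure P {\<omega> \<in> space P. \<epsilon> < dist (\<beta>hat t \<omega>) \<theta>}) \<longlonglongrightarrow> 0"
  proof (rule real_tendsto_sandwich)
    show "\<forall>\<^sub>F t in sequentially. 0 \<le> measure P {\<omega> \<in> space P. \<epsilon> < dist (\<beta>hat t \<omega>) \<theta>}" by simp
    show "\<forall>\<^sub>F t in sequentially. measure P {\<omega> \<in> space P. \<epsilon> < dist (\<beta>hat t \<omega>) \<theta>}
        \<le> (\<integral>\<omega>. deviation (\<beta>hat t \<omega>) \<partial>P) / \<delta>"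
    proof (intro eventually_sequentiallyI[of 1])
      fix t :: nat assume t: "1 \<le> t"
      have "measure P {\<omega> \<in> space P. \<epsilon> < dist (\<beta>hat t \<omega>) \<theta>} \<le> measure P {\<omega> \<in> space P. \<delta> \<le> deviation (\<beta>hat t \<omega>)}"
      proof (rule finite_measure_mono)
        show "{\<omega> \<in> space P. \<delta> \<le> deviation (\<beta>hat t \<omega>)} \<in> events"
          using deviation_measurable[OF t] by measurable
      qed (use large in auto)
      also have "\<dots> \<le> (\<integral>\<omega>. deviation (\<beta>hat t \<omega>) \<partial>P) / \<delta>"
        by (rule integral_Markov_inequality_measure[OF deviation_integrable[OF t] sets.empty_sets])
           (use \<delta> deviation_bounds in auto)
      finally show "measure P {\<omega> \<in> space P. \<epsilon> < dist (\<beta>hat t \<omega>) \<theta>} \<le> (\<integral>\<omega>. deviation (\<beta>hat t \<omega>) \<partial>P) / \<delta>" .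
    qed
    show "(\<lambda>t. (\<integral>\<omega>. deviation (\<beta>hat t \<omega>) \<partial>P) / \<delta>) \<longlonglongrightarrow> 0"
      using tendsto_divide[OF deviation_tendsto tendsto_const[of \<delta>]] \<delta> by simp
  qed auto
qed

end

lemma ridge_converges: "\<exists>\<theta>. tendsto_in_prob P \<beta>hat \<theta>"
  using population_fixed_point \<beta>hat_tendsto by blast

lemma policy_converges:
  assumes conv: "tendsto_in_prob P \<beta>hat \<theta>"
  shows "tendsto_in_prob P (\<lambda>t \<omega>. policy (X t \<omega>) (\<beta>hat t \<omega>) $ a - policy (X t \<omega>) \<theta> $ a) 0"
  unfolding tendsto_in_prob_def
proof (intro conjI allI impI)
  let ?f = "\<lambda>t \<omega>. policy (X t \<omega>) (\<beta>hat t \<omega>) $ a - policy (X t \<omega>) \<theta> $ a"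
  show "\<forall>\<^sub>F t in sequentially. ?f t \<in> borel_measurable P"
    by (intro eventually_sequentiallyI[of 1] borel_measurable_diff policy_measurable' X_measurable
        \<beta>hat_measurable borel_measurable_const)
  fix \<epsilon> :: real assume \<epsilon>: "0 < \<epsilon>"
  \<comment> \<open>Chosen so that the Lipschitz constant \<open>4 * M / \<gamma>\<close> turns a
    parameter distance \<open>\<delta>\<close> into a policy distance
    \<open>\<epsilon>\<close>.\<close>
  define \<delta> where "\<delta> = \<epsilon> * \<gamma> / (4 * M)"
  have "0 < \<delta>" using \<epsilon> pos by (simp add: \<delta>_def)
  show "(\<lambda>t. measure P {\<omega> \<in> space P. \<epsilon> < dist (?f t \<omega>) 0}) \<longlonglongrightarrow> 0"
  proof (rule real_tendsto_sandwich)
    show "\<forall>\<^sub>F t in sequentially. 0 \<le> measure P {\<omega> \<in> space P. \<epsilon> < dist (?f t \<omega>) 0}" by simp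
    show "\<forall>\<^sub>F t in sequentially. measure P {\<omega> \<in> space P. \<epsilon> < dist (?f t \<omega>) 0}
        \<le> measure P {\<omega> \<in> space P. \<delta> < dist (\<beta>hat t \<omega>) \<theta>}"
    proof (intro eventually_sequentiallyI[of 1] finite_measure_mono_AE)
      fix t :: nat assume t: "1 \<le> t"
      show "AE \<omega> in P. \<omega> \<in> {\<omega> \<in> space P. \<epsilon> < dist (?f t \<omega>) 0} \<longrightarrow> \<omega> \<in> {\<omega> \<in> space P. \<delta> < dist (\<beta>hat t \<omega>) \<theta>}"
        using X_bounded[OF t]
      proof eventually_elim
        case (elim \<omega>)
        have "\<bar>?f t \<omega>\<bar> \<le> 4 * M / \<gamma> * dist (\<beta>hat t \<omega>) \<theta>"
          using Finite_Cartesian_Product.norm_nth_le[of "\<beta>hat t \<omega> - \<theta>"] elim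
          by (intro clipped_boltzmann_lipschitz \<pi>min pos) (auto simp: dist_norm)
        moreover have "\<epsilon> = 4 * M / \<gamma> * \<delta>" using pos by (simp add: \<delta>_def)
        ultimately have "4 * M / \<gamma> * \<delta> < 4 * M / \<gamma> * dist (\<beta>hat t \<omega>) \<theta>" if "\<epsilon> < \<bar>?f t \<omega>\<bar>"
          using that by linarith
        then show ?case
          using pos by (auto simp: mult_less_cancel_left_pos divide_pos_pos simp del: times_divide_eq_left)
      qed
      show "{\<omega> \<in> space P. \<delta> < dist (\<beta>hat t \<omega>) \<theta>} \<in> events"
        using \<beta>hat_measurable[OF t] by measurable
    qed
    show "(\<lambda>t. measure P {\<omega> \<in> space P. \<delta> < dist (\<beta>hat t \<omega>) \<theta>}) \<longlonglongrightarrow> 0"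
      using conv \<open>0 < \<delta>\<close> by (simp add: tendsto_in_prob_def)
  qed auto
qed

end

theorem proposition4p4:
  fixes P :: "'w measure"
    and S :: "(real^'d::finite) set"
    and X :: "nat \<Rightarrow> 'w \<Rightarrow> real^'d"
    and Ypot :: "nat \<Rightarrow> 'w \<Rightarrow> real^'k::finite"
    and p :: "nat \<Rightarrow> 'w \<Rightarrow> real^'k"
    and A :: "nat \<Rightarrow> 'w \<Rightarrow> 'k"
    and Y :: "nat \<Rightarrow> 'w \<Rightarrow> real"
    and \<beta>hat :: "nat \<Rightarrow> 'w \<Rightarrow> real^'d^'k"
    and y :: "real^'d \<Rightarrow> 'k \<Rightarrow> real"
    and \<eta> :: "nat \<Rightarrow> 'w \<Rightarrow> real"
    and M \<sigma>min Ry \<sigma>\<eta> \<pi>min \<gamma> lam :: real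
  defines "Y \<equiv> observed A Ypot"
    and "\<beta>hat \<equiv> ridge lam X A Y"
  assumes bandit: "contextual_bandit P S X Ypot p A"
    and \<pi>min: "0 < \<pi>min" "\<pi>min < 1" "real CARD('k) * \<pi>min < 1"
    and pos: "M > 0" "\<sigma>min > 0" "Ry > 0" "\<sigma>\<eta> > 0" "\<gamma> > 0" "lam > 0"
    and X_bounded: "\<And>t. t \<ge> 1 \<Longrightarrow> AE \<omega> in P. norm (X t \<omega>) \<le> M"
    and X_cov: "\<And>t. t \<ge> 1 \<Longrightarrow>
          loewner_le (mat (\<sigma>min\<^sup>2)) (integral\<^sup>L P (\<lambda>\<omega>. outer (X t \<omega>) (X t \<omega>)))"
    and reward: "reward_model P S X p A Y y \<eta> \<sigma>\<eta>"
    and y_bounded: "\<And>x a. x \<in> S \<Longrightarrow> norm x \<le> M \<Longrightarrow> \<bar>y x a\<bar> \<le> Ry"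
    and behavior: "\<And>t \<omega>. t \<ge> 1 \<Longrightarrow> \<omega> \<in> space P \<Longrightarrow>
          p t \<omega> = clipped_boltzmann \<pi>min \<gamma> (X t \<omega>) (\<beta>hat t \<omega>)"
    and temperature: "\<gamma> \<ge> 2 * M^3 *
          max (2 / (\<pi>min * \<sigma>min\<^sup>2))
              (8 * (M * Ry + 4 * M * \<sigma>\<eta> * sqrt (real CARD('d) * real CARD('k)))
                 / (\<pi>min\<^sup>2 * \<sigma>min^4))
          * real CARD('k) * (real CARD('k) + 1)"
  shows "(\<exists>\<beta>bar :: real^'d^'k. tendsto_in_prob P \<beta>hat \<beta>bar) \<and>
    (\<exists>\<pi>bar :: real^'d \<Rightarrow> real^'k.
       \<pi>bar \<in> borel_measurable (restrict_space borel S) \<and>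
       (\<forall>x\<in>S. \<pi>bar x \<in> prob_simplex) \<and>
       (\<forall>a. tendsto_in_prob P
              (\<lambda>t \<omega>. clipped_boltzmann \<pi>min \<gamma> (X t \<omega>) (\<beta>hat t \<omega>) $ a - \<pi>bar (X t \<omega>) $ a) 0))"
proof -
  interpret contextual_bandit P S X Ypot p A by (rule bandit)
  let ?K = "real CARD('k)" and ?c = "\<pi>min * \<sigma>min\<^sup>2"
  have c: "0 < ?c" using \<pi>min pos by simp
  have K: "1 \<le> ?K" by (simp add: Suc_leI)
  \<comment> \<open>Here \<open>?K + 1\<close> is at least 2, which doubles \<open>2 * 8\<close> to
    32.\<close>
  have "32 * M^4 * Ry * ?K / ?c\<^sup>2 \<le> 2 * M^3 * (8 * (M * Ry) / ?c\<^sup>2) * ?K * (?K + 1)"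
  proof -
    have "16 * M^4 * Ry * ?K / ?c\<^sup>2 * 2 \<le> 16 * M^4 * Ry * ?K / ?c\<^sup>2 * (?K + 1)"
      using K pos by (intro mult_left_mono) auto
    then show ?thesis by (simp add: eval_nat_numeral mult_ac)
  qed
  also have "\<dots> \<le> 2 * M^3 *
          max (2 / (\<pi>min * \<sigma>min\<^sup>2))
              (8 * (M * Ry + 4 * M * \<sigma>\<eta> * sqrt (real CARD('d) * ?K)) / (\<pi>min\<^sup>2 * \<sigma>min^4))
          * ?K * (?K + 1)"
  proof (intro mult_right_mono mult_left_mono)
    \<comment> \<open>The second entry of the maximum dominates because its noise contribution is
      nonnegative.\<close>
    have "8 * (M * Ry) / ?c\<^sup>2 \<le> 8 * (M * Ry + 4 * M * \<sigma>\<eta> * sqrt (real CARD('d) * ?K)) / ?c\<^sup>2"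
      using pos by (intro divide_right_mono mult_left_mono) auto
    then show "8 * (M * Ry) / ?c\<^sup>2 \<le> max (2 / (\<pi>min * \<sigma>min\<^sup>2))
        (8 * (M * Ry + 4 * M * \<sigma>\<eta> * sqrt (real CARD('d) * ?K)) / (\<pi>min\<^sup>2 * \<sigma>min^4))"
      by (simp add: power_mult_distrib flip: power_mult)
  qed (use pos in auto)
  also have "\<dots> \<le> \<gamma>" by (rule temperature)
  finally have "32 * M^4 * Ry * ?K \<le> \<gamma> * ?c\<^sup>2"
    using zero_less_power[OF c, of 2] by (simp only: pos_divide_le_eq)
  then interpret ridge_bandit P S X Ypot p A y \<eta> M \<sigma>min Ry \<sigma>\<eta> \<pi>min \<gamma> lam
    using \<pi>min pos X_bounded X_cov[OF order_refl] reward y_bounded behavior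
    unfolding Y_def \<beta>hat_def by unfold_locales auto
  obtain \<theta> :: "real^'d^'k" where \<theta>: "tendsto_in_prob P (ridge lam X A (observed A Ypot)) \<theta>"
    using ridge_converges by blast
  have "(\<lambda>x. policy x \<theta>) \<in> borel_measurable (restrict_space borel S)"
    unfolding context_algebra_def[symmetric]
    by (intro borel_measurable_vecI policy_measurable' measurable_ident_sets[OF refl] borel_measurable_const)
  moreover have "policy x \<theta> \<in> prob_simplex" for x
    unfolding clipped_boltzmann_def by (rule clip_in_prob_simplex) (use \<pi>min in auto)
  ultimately show ?thesis
    unfolding Y_def \<beta>hat_def using \<theta> policy_converges[OF \<theta>] by blast
qed

end
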